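(* Let $q$ be a power of an odd prime $p$, let $\tau\in\mathbb{F}_q^{*}$ with $\tau\neq 1$, and let $c\in\mathbb{F}_q^{*}$ be a non-square. Then the group $\Gamma_\tau$ is not poly-context-free, i.e. the word problem of $\Gamma_\tau$ is not an intersection of finitely many context-free languages.
   Context: Word problem: for a finitely generated group $G$ and a finite symmetric generating set $S=S^{-1}$ of $G$, the word problem is the language $\mathrm{WP}(G,S)=\{w\in S^{*} : w=_G e\}$ over the alphabet $S$. A language is poly-context-free if it is an intersection of finitely many context-free languages. A finitely generated group $G$ is poly-context-free if $\mathrm{WP}(G,S)$ is poly-context-free for some (equivalently, every) finite symmetric generating set $S$. The groups $\Gamma_\tau$: let $K=\mathbb{F}_q(t)$ be the rational function field, and let $D$ be the quaternion algebra over $K$ with $K$-basis $1,Z,F,ZF$ and multiplication $Z^2=c$, $F^2=t(t-1)$, $ZF=-FZ$. The subset $\mathbb{F}_q[Z]\subset D$ is a field with $q^2$ elements, with norm $N(\xi)=\xi\overline{\xi}=\xi^{q+1}\in\mathbb{F}_q$, where $\overline{\xi}=\xi^q$. Put $N_c=\{\xi\in\mathbb{F}_q[Z]^{*} : N(\xi)=-c\}$ and $M_\tau=\{\eta\in\mathbb{F}_q[Z]^{*} : N(\eta)=\frac{c\tau}{1-\tau}\}$. Then $\Gamma_\tau$ is the subgroup of $D^{*}/K^{*}$ generated by $A\cup B_\tau$, where $A$ is the set of classes of the elements $a_\xi:=ct+\xi FZ$, $\xi\in N_c$, and $B_\tau$ is the set of classes of the elements $b_\eta:=ct+\eta FZ$,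 $\eta\in M_\tau$. (The sets $A$ and $B_\tau$ are disjoint and closed under inverses.) *)

theory Defs
  imports
    "HOL-Algebra.Generated_Groups"
    "HOL-Algebra.Ring"
    "HOL-Computational_Algebra.Polynomial_Factorial"
    "HOL-Library.Cardinality"
begin

section \<open>Poly-context-free languages\<close>

text \<open>A grammar is a start symbol together with a set of productions; in a sentential form
  \<^term>\<open>Inl A\<close> is a nonterminal and \<^term>\<open>Inr a\<close> is a terminal.\<close>

type_synonym ('n, 't) grammar = "'n \<times> ('n \<times> ('n + 't) list) set"

inductive derives1 ::
    "('n, 't) grammar \<Rightarrow> ('n + 't) list \<Rightarrow> ('n + 't) list \<Rightarrow> bool" for \<G> where
  "(A, v) \<in> snd \<G> \<Longrightarrow> derives1 \<G> (u @ [Inl A] @ w) (u @ v @ w)"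

definition grammar_language :: "('n, 't) grammar \<Rightarrow> 't list set" where
  "grammar_language \<G> = {w. (derives1 \<G>)\<^sup>*\<^sup>* [Inl (fst \<G>)] (map Inr w)}"

definition context_free_grammar_over :: "'t set \<Rightarrow> ('n, 't) grammar \<Rightarrow> bool" where
  "context_free_grammar_over \<Sigma> \<G> \<longleftrightarrow>
     finite (snd \<G>) \<and> (\<forall>(A, v) \<in> snd \<G>. \<forall>a. Inr a \<in> set v \<longrightarrow> a \<in> \<Sigma>)"

text \<open>Only finitely many nonterminals occur in a grammar with finitely many productions, so
  natural numbers suffice as their names.\<close>

definition context_free :: "'t set \<Rightarrow> 't list set \<Rightarrow> bool" where
  "context_free \<Sigma> L \<longleftrightarrow>
     (\<exists>\<G> :: (nat, 't) grammar. context_free_grammar_over \<Sigma> \<G> \<and> L = grammar_language \<G>)"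

text \<open>Requiring at least one language loses nothing, because the empty intersection would be
  \<^term>\<open>lists \<Sigma>\<close>, which is context-free for finite \<open>\<Sigma>\<close>.\<close>

definition poly_context_free :: "'t set \<Rightarrow> 't list set \<Rightarrow> bool" where
  "poly_context_free \<Sigma> L \<longleftrightarrow>
     (\<exists>\<L>. finite \<L> \<and> \<L> \<noteq> {} \<and> (\<forall>L' \<in> \<L>. context_free \<Sigma> L') \<and> L = \<Inter>\<L>)"


section \<open>Word problems of finitely generated groups\<close>

definition word_value :: "('g, 'm) monoid_scheme \<Rightarrow> 'g list \<Rightarrow> 'g" where
  "word_value G w = foldr (\<otimes>\<^bsub>G\<^esub>) w \<one>\<^bsub>G\<^esub>"

definition word_problem :: "('g, 'm) monoid_scheme \<Rightarrow> 'g set \<Rightarrow> 'g list set" where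
  "word_problem G S = {w \<in> lists S. word_value G w = \<one>\<^bsub>G\<^esub>}"

definition finite_symmetric_generating_set :: "('g, 'm) monoid_scheme \<Rightarrow> 'g set \<Rightarrow> bool" where
  "finite_symmetric_generating_set G S \<longleftrightarrow>
     finite S \<and> S \<subseteq> carrier G \<and> m_inv G ` S = S \<and> generate G S = carrier G"

definition poly_context_free_group :: "('g, 'm) monoid_scheme \<Rightarrow> bool" where
  "poly_context_free_group G \<longleftrightarrow>
     (\<exists>S. finite_symmetric_generating_set G S \<and> poly_context_free S (word_problem G S))"


section \<open>Quaternion algebras\<close>

text \<open>\<^term>\<open>Quat w x y z\<close> stands for \<open>w + x Z + y F + z ZF\<close>.\<close>

datatype 'k quat = Quat (re_part: 'k) (Z_part: 'k) (F_part: 'k) (ZF_part: 'k)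

text \<open>The product is the bilinear associative one determined by
  \<open>Z\<^sup>2 = \<alpha>\<close>, \<open>F\<^sup>2 = \<beta>\<close> and \<open>ZF = -FZ\<close>.\<close>

definition quat_mult :: "'k::field \<Rightarrow> 'k \<Rightarrow> 'k quat \<Rightarrow> 'k quat \<Rightarrow> 'k quat" where
  "quat_mult \<alpha> \<beta> p r =
     (case (p, r) of (Quat w x y z, Quat w' x' y' z') \<Rightarrow>
       Quat (w * w' + \<alpha> * x * x' + \<beta> * y * y' - \<alpha> * \<beta> * z * z')
            (w * x' + x * w' - \<beta> * y * z' + \<beta> * z * y')
            (w * y' + y * w' + \<alpha> * x * z' - \<alpha> * z * x')
            (w * z' + z * w' + x * y' - y * x'))"

definition quat_add :: "'k::field quat \<Rightarrow> 'k quat \<Rightarrow> 'k quat" where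
  "quat_add p r =
     (case (p, r) of (Quat w x y z, Quat w' x' y' z') \<Rightarrow>
       Quat (w + w') (x + x') (y + y') (z + z'))"

definition quat_scalar :: "'k::field \<Rightarrow> 'k quat" where
  "quat_scalar a = Quat a 0 0 0"

definition quat_Z :: "'k::field quat" where
  "quat_Z = Quat 0 1 0 0"

definition quat_F :: "'k::field quat" where
  "quat_F = Quat 0 0 1 0"

definition quat_ring :: "'k::field \<Rightarrow> 'k \<Rightarrow> 'k quat ring" where
  "quat_ring \<alpha> \<beta> =
     \<lparr>carrier = UNIV, monoid.mult = quat_mult \<alpha> \<beta>, one = quat_scalar 1,
      zero = quat_scalar 0, add = quat_add\<rparr>"

lemmas quat_defs = quat_mult_def quat_add_def quat_scalar_def quat_Z_def quat_F_def

lemma quat_ring_simps [simp]: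
  "carrier (quat_ring \<alpha> \<beta>) = UNIV"
  "monoid.mult (quat_ring \<alpha> \<beta>) = quat_mult \<alpha> \<beta>"
  "monoid.one (quat_ring \<alpha> \<beta>) = quat_scalar 1"
  "ring.zero (quat_ring \<alpha> \<beta>) = quat_scalar 0"
  "ring.add (quat_ring \<alpha> \<beta>) = quat_add"
  by (simp_all add: quat_ring_def)

lemma quat_relations:
  "quat_mult \<alpha> \<beta> quat_Z quat_Z = quat_scalar \<alpha>"
  "quat_mult \<alpha> \<beta> quat_F quat_F = quat_scalar \<beta>"
  "quat_mult \<alpha> \<beta> quat_Z quat_F = Quat 0 0 0 1"
  "quat_mult \<alpha> \<beta> quat_F quat_Z = Quat 0 0 0 (-1)"
  by (simp_all add: quat_defs)

lemma ring_quat_ring: "ring (quat_ring \<alpha> \<beta>)"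
proof (rule ringI)
  show "abelian_group (quat_ring \<alpha> \<beta>)"
  proof (rule abelian_groupI)
    fix x :: "'a quat"
    show "\<exists>y\<in>carrier (quat_ring \<alpha> \<beta>). y \<oplus>\<^bsub>quat_ring \<alpha> \<beta>\<^esub> x = \<zero>\<^bsub>quat_ring \<alpha> \<beta>\<^esub>"
      by (cases x, rule bexI[of _ "Quat (- re_part x) (- Z_part x) (- F_part x) (- ZF_part x)"])
        (auto simp: quat_defs)
  qed (auto simp: quat_defs split: quat.splits)
  show "monoid (quat_ring \<alpha> \<beta>)"
    by (rule monoidI) (auto simp: quat_defs algebra_simps split: quat.splits)
qed (auto simp: quat_defs algebra_simps split: quat.splits)


section \<open>The groups \<open>\<Gamma>\<^sub>\<tau>\<close>\<close>

text \<open>The type \<^typ>\<open>'a poly fract\<close> is the rational function field over the finite field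
  \<^typ>\<open>'a\<close>.\<close>

definition ratfun_const :: "'a::{field,finite} \<Rightarrow> 'a poly fract" where
  "ratfun_const a = to_fract [:a:]"

definition ratfun_t :: "'a::{field,finite} poly fract" where
  "ratfun_t = to_fract [:0, 1:]"

definition D_alg :: "'a::{field,finite} \<Rightarrow> 'a poly fract quat ring" where
  "D_alg c = quat_ring (ratfun_const c) (ratfun_t * (ratfun_t - 1))"

definition K_units :: "'a::{field,finite} poly fract quat set" where
  "K_units = quat_scalar ` (UNIV - {0})"

definition D_units_mod_K_units :: "'a::{field,finite} \<Rightarrow> 'a poly fract quat set monoid" where
  "D_units_mod_K_units c = units_of (D_alg c) Mod K_units"

definition D_class :: "'a::{field,finite} \<Rightarrow> 'a poly fract quat \<Rightarrow> 'a poly fract quat set" where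
  "D_class c x = K_units #>\<^bsub>units_of (D_alg c)\<^esub> x"

definition Fq_Z :: "'a::{field,finite} \<Rightarrow> 'a poly fract quat set" where
  "Fq_Z c = {quat_scalar (ratfun_const x) \<oplus>\<^bsub>D_alg c\<^esub>
             quat_scalar (ratfun_const y) \<otimes>\<^bsub>D_alg c\<^esub> quat_Z | x y. True}"

definition Fq_Z_conj :: "'a::{field,finite} \<Rightarrow> 'a poly fract quat \<Rightarrow> 'a poly fract quat" where
  "Fq_Z_conj c \<xi> = \<xi> [^]\<^bsub>D_alg c\<^esub> CARD('a)"

definition Fq_Z_norm :: "'a::{field,finite} \<Rightarrow> 'a poly fract quat \<Rightarrow> 'a poly fract quat" where
  "Fq_Z_norm c \<xi> = \<xi> \<otimes>\<^bsub>D_alg c\<^esub> Fq_Z_conj c \<xi>"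

definition norm_fibre :: "'a::{field,finite} \<Rightarrow> 'a \<Rightarrow> 'a poly fract quat set" where
  "norm_fibre c n =
     {\<xi> \<in> Fq_Z c - {\<zero>\<^bsub>D_alg c\<^esub>}. Fq_Z_norm c \<xi> = quat_scalar (ratfun_const n)}"

text \<open>The element \<open>ct + \<xi>FZ\<close>.\<close>

definition gen_elem :: "'a::{field,finite} \<Rightarrow> 'a poly fract quat \<Rightarrow> 'a poly fract quat" where
  "gen_elem c \<xi> =
     quat_scalar (ratfun_const c * ratfun_t) \<oplus>\<^bsub>D_alg c\<^esub>
     \<xi> \<otimes>\<^bsub>D_alg c\<^esub> (quat_F \<otimes>\<^bsub>D_alg c\<^esub> quat_Z)"

definition gens_A :: "'a::{field,finite} \<Rightarrow> 'a poly fract quat set set" where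
  "gens_A c = (\<lambda>\<xi>. D_class c (gen_elem c \<xi>)) ` norm_fibre c (- c)"

definition gens_B :: "'a::{field,finite} \<Rightarrow> 'a \<Rightarrow> 'a poly fract quat set set" where
  "gens_B c \<tau> = (\<lambda>\<eta>. D_class c (gen_elem c \<eta>)) ` norm_fibre c (c * \<tau> / (1 - \<tau>))"

definition \<Gamma> :: "'a::{field,finite} \<Rightarrow> 'a \<Rightarrow> 'a poly fract quat set monoid" where
  "\<Gamma> c \<tau> = subgroup_generated (D_units_mod_K_units c) (gens_A c \<union> gens_B c \<tau>)"


text \<open>The generators are units modulo \<^term>\<open>K_units\<close>, so the intersection with the carrier in
  \<^const>\<open>subgroup_generated\<close> discards nothing, and they form a finite symmetric set.\<close>

lemma quat_ring_UnitsI: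
  assumes "p \<noteq> 0" "quat_mult \<alpha> \<beta> x y = quat_scalar p" "quat_mult \<alpha> \<beta> y x = quat_scalar p"
  shows "x \<in> Units (quat_ring \<alpha> \<beta>)"
proof -
  let ?z = "quat_mult \<alpha> \<beta> (quat_scalar (inverse p)) y"
  interpret ring "quat_ring \<alpha> \<beta>" by (rule ring_quat_ring)
  have s: "quat_mult \<alpha> \<beta> x (quat_scalar u) = quat_mult \<alpha> \<beta> (quat_scalar u) x" for u x
    by (cases x) (simp add: quat_defs)
  have i: "quat_mult \<alpha> \<beta> (quat_scalar (inverse p)) (quat_scalar p) = quat_scalar 1"
    using assms(1) by (simp add: quat_defs)
  have as: "quat_mult \<alpha> \<beta> (quat_mult \<alpha> \<beta> a b) d = quat_mult \<alpha> \<beta> a (quat_mult \<alpha> \<beta> b d)" for a b d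
    using m_assoc[of a b d] by simp
  have "quat_mult \<alpha> \<beta> ?z x = quat_scalar 1" by (simp add: as assms i)
  moreover have "quat_mult \<alpha> \<beta> x ?z = quat_scalar 1" by (metis as assms(2) i s)
  ultimately show ?thesis by (auto simp: Units_def)
qed

lemma K_units_normal:
  fixes c :: "'a::{field,finite}"
  shows "K_units \<lhd> units_of (D_alg c)"
proof -
  interpret ring "D_alg c" unfolding D_alg_def by (rule ring_quat_ring)
  interpret U: group "units_of (D_alg c)" by (rule units_group)
  note D_alg_def[simp]
  have s: "x \<otimes>\<^bsub>D_alg c\<^esub> quat_scalar u = quat_scalar u \<otimes>\<^bsub>D_alg c\<^esub> x" for u x
    by (cases x) (simp add: quat_defs)
  have k: "K_units \<subseteq> carrier (units_of (D_alg c))"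
  proof
    fix x :: "'a poly fract quat" assume "x \<in> K_units"
    then obtain u where u: "u \<noteq> 0" "x = quat_scalar u" by (auto simp: K_units_def)
    show "x \<in> carrier (units_of (D_alg c))" unfolding units_of_carrier D_alg_def
      by (rule quat_ring_UnitsI[of 1 _ _ _ "quat_scalar (inverse u)"]) (use u in \<open>auto simp: quat_defs\<close>)
  qed
  have m: "quat_scalar u \<otimes>\<^bsub>units_of (D_alg c)\<^esub> quat_scalar v = quat_scalar (u*v)" for u v
    by (simp add: units_of_mult quat_defs)
  have o: "\<one>\<^bsub>units_of (D_alg c)\<^esub> = quat_scalar 1" by (simp add: units_of_one)
  have sub: "subgroup K_units (units_of (D_alg c))"
  proof (rule U.subgroupI[OF k])
    show "(K_units :: 'a poly fract quat set) \<noteq> {}"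
    proof -
      have "(quat_scalar 1 :: 'a poly fract quat) \<in> K_units" by (simp add: K_units_def)
      then show ?thesis by blast
    qed
    fix a :: "'a poly fract quat" assume a: "a \<in> K_units"
    then obtain u where u: "u \<noteq> 0" "a = quat_scalar u" by (auto simp: K_units_def)
    have "quat_scalar (inverse u) \<in> K_units" using u by (auto simp: K_units_def)
    moreover have "inv\<^bsub>units_of (D_alg c)\<^esub> a = quat_scalar (inverse u)"
      apply (rule U.inv_equality)
      using u m o k a calculation by (auto simp del: D_alg_def)
    ultimately show "inv\<^bsub>units_of (D_alg c)\<^esub> a \<in> K_units" by simp
    fix b :: "'a poly fract quat" assume "b \<in> K_units"
    then show "a \<otimes>\<^bsub>units_of (D_alg c)\<^esub> b \<in> K_units" using u m by (auto simp: K_units_def simp del: D_alg_def)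
  qed
  show ?thesis
  proof (rule U.normal_invI[OF sub])
    fix x h :: "'a poly fract quat"
    assume x: "x \<in> carrier (units_of (D_alg c))" and h: "h \<in> K_units"
    have xh: "x \<otimes>\<^bsub>units_of (D_alg c)\<^esub> h = h \<otimes>\<^bsub>units_of (D_alg c)\<^esub> x"
      using h s by (auto simp: K_units_def units_of_mult simp del: D_alg_def)
    have hU: "h \<in> carrier (units_of (D_alg c))"
      using h k by blast
    have "x \<otimes>\<^bsub>units_of (D_alg c)\<^esub> h \<otimes>\<^bsub>units_of (D_alg c)\<^esub> inv\<^bsub>units_of (D_alg c)\<^esub> x
        = h \<otimes>\<^bsub>units_of (D_alg c)\<^esub> (x \<otimes>\<^bsub>units_of (D_alg c)\<^esub> inv\<^bsub>units_of (D_alg c)\<^esub> x)"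
      unfolding xh by (rule U.m_assoc[OF hU x U.inv_closed[OF x]])
    also have "\<dots> = h"
      unfolding U.r_inv[OF x] by (rule U.r_one[OF hU])
    finally show "x \<otimes>\<^bsub>units_of (D_alg c)\<^esub> h \<otimes>\<^bsub>units_of (D_alg c)\<^esub> inv\<^bsub>units_of (D_alg c)\<^esub> x \<in> K_units"
      using h by (simp only:)
  qed
qed

lemma Fq_Z_eq: "Fq_Z c = {Quat (ratfun_const x) (ratfun_const y) 0 0 | x y. True}"
  by (simp add: Fq_Z_def D_alg_def quat_defs)

lemma gen_elem_mult_conj:
  fixes c :: "'a::{field,finite}"
  assumes "c \<noteq> 0" "\<xi> \<in> Fq_Z c"
  obtains p \<xi>' where "p \<noteq> 0" "gen_elem c \<xi> \<otimes>\<^bsub>D_alg c\<^esub> gen_elem c \<xi>' = quat_scalar p"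
    "gen_elem c \<xi>' \<otimes>\<^bsub>D_alg c\<^esub> gen_elem c \<xi> = quat_scalar p" "\<xi>' = Quat (- re_part \<xi>) (-Z_part \<xi>) 0 0"
proof -
  obtain x y where xy: "\<xi> = Quat (ratfun_const x) (ratfun_const y) 0 0" using assms by (auto simp: Fq_Z_eq)
  let ?C = "ratfun_const c" and ?t = "ratfun_t :: 'a poly fract"
  let ?n = "ratfun_const x * ratfun_const x - ?C * ratfun_const y * ratfun_const y"
  let ?p = "?C * ?C * ?t * ?t + ?C * ?n * ?t * (?t - 1)"
  have "?p = to_fract ([:c:] * [:c:] * [:0,1:] * [:0,1:] + [:c:] * ([:x:]*[:x:] - [:c:] * [:y:]*[:y:]) * [:0,1:] * ([:0,1:] - 1))"
    unfolding ratfun_const_def ratfun_t_def to_fract_mult[symmetric] to_fract_diff[symmetric] to_fract_add[symmetric] to_fract_1[symmetric] ..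
  moreover have "\<dots> \<noteq> 0" unfolding to_fract_eq_0_iff
    using assms(1) by (auto simp: one_pCons)
  ultimately have "?p \<noteq> 0" by simp
  then show thesis
    apply (rule that)
    by (auto simp: xy gen_elem_def D_alg_def quat_defs algebra_simps)
qed

lemma quat_pow_Suc:
  "x [^]\<^bsub>quat_ring \<alpha> \<beta>\<^esub> Suc n = quat_mult \<alpha> \<beta> (x [^]\<^bsub>quat_ring \<alpha> \<beta>\<^esub> n) x"
  using monoid.nat_pow_Suc[OF ring.is_monoid[OF ring_quat_ring]] by simp

lemma quat_uminus_pow:
  "Quat (- a) (- b) 0 0 [^]\<^bsub>quat_ring \<alpha> \<beta>\<^esub> (n::nat) =
     quat_mult \<alpha> \<beta> (quat_scalar ((- 1) ^ n)) (Quat a b 0 0 [^]\<^bsub>quat_ring \<alpha> \<beta>\<^esub> n)"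
proof (induction n)
  case 0
  show ?case by (simp add: quat_defs Group.nat_pow_def)
next
  case (Suc n)
  obtain w x y z where P: "Quat a b 0 0 [^]\<^bsub>quat_ring \<alpha> \<beta>\<^esub> n = Quat w x y z"
    by (rule quat.exhaust)
  show ?case
    unfolding quat_pow_Suc Suc P by (simp add: quat_defs algebra_simps)
qed

lemma norm_fibre_uminus:
  fixes c :: "'a::{field,finite}"
  assumes "\<xi> \<in> norm_fibre c n" "odd (CARD('a))"
  shows "Quat (- re_part \<xi>) (-Z_part \<xi>) 0 0 \<in> norm_fibre c n"
proof -
  obtain x y where xy: "\<xi> = Quat (ratfun_const x) (ratfun_const y) 0 0" using assms by (auto simp: Fq_Z_eq norm_fibre_def)
  let ?\<xi>' = "Quat (- re_part \<xi>) (-Z_part \<xi>) 0 0"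
  have "?\<xi>' \<in> Fq_Z c" unfolding Fq_Z_eq
    by (auto simp: xy ratfun_const_def to_fract_uminus[symmetric] simp del: to_fract_uminus intro!: exI[of _ "-x"] exI[of _ "-y"])
  moreover have "Fq_Z_norm c ?\<xi>' = Fq_Z_norm c \<xi>"
  proof -
    let ?D = "quat_ring (ratfun_const c) (ratfun_t * (ratfun_t - 1))"
    obtain w x' y' z where
      P: "Quat (ratfun_const x) (ratfun_const y) 0 0 [^]\<^bsub>?D\<^esub> CARD('a) = Quat w x' y' z"
      by (rule quat.exhaust)
    show ?thesis
      unfolding Fq_Z_norm_def Fq_Z_conj_def D_alg_def xy quat.sel quat_uminus_pow P
      using assms(2) by (simp add: quat_defs)
  qed
  moreover have "?\<xi>' \<noteq> \<zero>\<^bsub>D_alg c\<^esub>" using assms xy by (auto simp: norm_fibre_def D_alg_def quat_defs)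
  ultimately show ?thesis using assms by (auto simp: norm_fibre_def)
qed

lemma gens_generate_Gamma:
  fixes c \<tau> :: "'a::{field,finite}"
  assumes "c \<noteq> 0" "odd (CARD('a))"
  shows "gens_A c \<union> gens_B c \<tau> \<subseteq> carrier (D_units_mod_K_units c)"
   "finite_symmetric_generating_set (\<Gamma> c \<tau>) (gens_A c \<union> gens_B c \<tau>)"
proof -
  let ?U = "units_of (D_alg c)" and ?S = "gens_A c \<union> gens_B c \<tau>" and ?G = "D_units_mod_K_units c"
  interpret R: ring "D_alg c" unfolding D_alg_def by (rule ring_quat_ring)
  interpret U: group ?U by (rule R.units_group)
  interpret N: normal K_units ?U by (rule K_units_normal)
  interpret G: group ?G unfolding D_units_mod_K_units_def by (rule N.factorgroup_is_group)
  have u: "gen_elem c \<xi> \<in> carrier ?U" if "\<xi> \<in> norm_fibre c n" for \<xi> n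
  proof -
    have "\<xi> \<in> Fq_Z c" using that by (auto simp: norm_fibre_def)
    from gen_elem_mult_conj[OF assms(1) this] show ?thesis unfolding units_of_carrier by (metis D_alg_def quat_ring_UnitsI quat_ring_simps(2))
  qed
  have cl: "D_class c x \<in> carrier ?G" if "x \<in> carrier ?U" for x
    unfolding D_class_def D_units_mod_K_units_def FactGroup_def using that by (auto simp: U.rcosetsI N.subset)
  show 1: "?S \<subseteq> carrier ?G"
    using u cl by (auto simp: gens_A_def gens_B_def)
  have iv: "inv\<^bsub>?G\<^esub> D_class c (gen_elem c \<xi>) = D_class c (gen_elem c (Quat (- re_part \<xi>) (-Z_part \<xi>) 0 0))"
    if xi: "\<xi> \<in> norm_fibre c n" for \<xi> n
  proof -
    let ?x = "Quat (- re_part \<xi>) (-Z_part \<xi>) 0 0"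
    note f = norm_fibre_uminus[OF xi assms(2)]
    have "\<xi> \<in> Fq_Z c" using that by (auto simp: norm_fibre_def)
    from gen_elem_mult_conj[OF assms(1) this] obtain p where p: "p \<noteq> 0" "gen_elem c ?x \<otimes>\<^bsub>D_alg c\<^esub> gen_elem c \<xi> = quat_scalar p" by metis
    have "D_class c (gen_elem c ?x) \<otimes>\<^bsub>?G\<^esub> D_class c (gen_elem c \<xi>) = K_units #>\<^bsub>?U\<^esub> (gen_elem c ?x \<otimes>\<^bsub>D_alg c\<^esub> gen_elem c \<xi>)"
      unfolding D_class_def D_units_mod_K_units_def FactGroup_def using N.rcos_sum[OF u[OF f] u[OF xi]] by (simp add: units_of_mult)
    also have "\<dots> = K_units" unfolding p(2) using p(1)
      by (intro U.coset_join2 N.subgroup_axioms) (use N.subset in \<open>auto simp: K_units_def\<close>)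
    finally have "D_class c (gen_elem c ?x) \<otimes>\<^bsub>?G\<^esub> D_class c (gen_elem c \<xi>) = \<one>\<^bsub>?G\<^esub>"
      by (simp add: D_units_mod_K_units_def FactGroup_def)
    then show ?thesis using G.inv_equality cl[OF u[OF f]] cl[OF u[OF xi]] by auto
  qed
  have car: "?S \<subseteq> carrier (\<Gamma> c \<tau>)" unfolding \<Gamma>_def using 1
    by (rule G.subgroup_generated_subset_carrier_subset)
  have S_inv: "inv\<^bsub>?G\<^esub> x \<in> ?S" if x: "x \<in> ?S" for x
    using x iv norm_fibre_uminus[OF _ assms(2)] by (fastforce simp: gens_A_def gens_B_def)
  have "finite (Fq_Z c)"
  proof -
    have "Fq_Z c = (\<lambda>(x,y). Quat (ratfun_const x) (ratfun_const y) 0 0) ` UNIV" by (auto simp: Fq_Z_eq)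
    then show ?thesis by simp
  qed
  then have fin: "finite ?S" by (auto simp: gens_A_def gens_B_def norm_fibre_def)
  have sub: "subgroup (generate ?G ?S) ?G" using 1 by (rule G.generate_is_subgroup)
  have G_eq: "\<Gamma> c \<tau> = ?G\<lparr>carrier := generate ?G ?S\<rparr>" using 1 by (simp add: \<Gamma>_def subgroup_generated_def Int_absorb1)
  have inv_eq: "inv\<^bsub>\<Gamma> c \<tau>\<^esub> x = inv\<^bsub>?G\<^esub> x" if "x \<in> ?S" for x
    unfolding G_eq using G.m_inv_consistent[OF sub] that by (simp add: generate.incl)
  have "m_inv (\<Gamma> c \<tau>) ` ?S = m_inv ?G ` ?S" using inv_eq by auto
  also have "\<dots> = ?S"
  proof -
    have "x \<in> m_inv ?G ` ?S" if "x \<in> ?S" for x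
      using S_inv[OF that] G.inv_inv[of x] that 1 by (metis image_eqI subsetD)
    then show ?thesis using S_inv by blast
  qed
  finally have i: "m_inv (\<Gamma> c \<tau>) ` ?S = ?S" .
  have "generate (\<Gamma> c \<tau>) ?S = carrier (\<Gamma> c \<tau>)"
    using G.generate_consistent[OF _ sub, of ?S] generate.incl[of _ ?S ?G] by (auto simp: G_eq)
  with fin car i show "finite_symmetric_generating_set (\<Gamma> c \<tau>) ?S"
    by (simp add: finite_symmetric_generating_set_def)
qed

end

theory Submission
  imports Defs
begin

text \<open>
  Write \<open>\<omega>\<^sub>\<xi> = \<xi>FZ\<close>, so that \<open>\<omega>\<^sub>\<xi>\<^sup>2 = -c N(\<xi>) t(t-1)\<close> is central. Take \<open>\<xi> = Z\<close> and some \<open>\<eta>\<close> with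
  \<open>N(\<eta>) = c\<tau>/(1-\<tau>)\<close> for which \<open>\<xi>\<eta>\<^sup>q\<close> is not in \<open>GF(q)\<close>. Put \<open>s = \<xi> + \<eta>\<close>, \<open>\<xi>' = \<xi>\<^sup>q s / s\<^sup>q\<close> and \<open>\<eta>' = \<eta>\<^sup>q s / s\<^sup>q\<close>. The four generators \<open>a, b, a', b'\<close> given by
  \<open>\<xi>, \<eta>, \<xi>', \<eta>'\<close> satisfy \<open>ab = b'a'\<close>, a square that does not commute. The proof compares the set
  \<open>X = {m. a\<^sup>m b\<^sup>m = b'\<^sup>m a'\<^sup>m}\<close> with what poly-context-freeness says about it.

  The powers are represented by \<open>a\<^sup>m = u + v\<omega>\<^sub>\<xi>\<close> and \<open>b\<^sup>m = u' + v'\<omega>\<^sub>\<eta>\<close>, with coefficients that depend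
  only on \<open>m\<close> and on the norms; hence \<open>a'\<^sup>m\<close> has the coefficients of \<open>a\<^sup>m\<close>, and \<open>b'\<^sup>m\<close> those of \<open>b\<^sup>m\<close>. If \<open>v\<close> and \<open>v'\<close> are nonzero, then
  \<open>m \<in> X\<close> holds exactly when \<open>uv' = u'v\<close> (\<open>twisted_commutation\<close>). In characteristic \<open>p\<close> the Frobenius
  map gives, for \<open>Q = q\<^bsup>2i\<^esup>\<close>, the coefficients \<open>u = u' = (ct)\<^sup>Q\<close> and \<open>v = v' = (t(t-1))\<^bsup>(Q-1)/2\<^esup>\<close>
  (\<open>frobenius_quad_pow\<close>), so all these \<open>Q\<close> lie in \<open>X\<close>. For two of them, \<open>P < Q\<close>, the number \<open>2Q - P\<close>
  does not: up to nonzero factors \<open>uv' - u'v\<close> is then the square of an explicit polynomial which,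
  after removal of a power of \<open>t(t-1)\<close>, does not vanish at \<open>t = 1\<close>
  (\<open>cross_product_identity\<close>, \<open>extrapolated_exponent_separates\<close>).

  An intersection of finitely many context-free languages cannot make this distinction. If it
  contains, for nonempty words \<open>x\<^sub>1, \<dots>, x\<^sub>r\<close>, the words \<open>x\<^sub>1\<^sup>n \<dots> x\<^sub>r\<^sup>n\<close> for all members \<open>n\<close> of a
  sequence of positive numbers \<open>n\<^sub>0, n\<^sub>1, \<dots>\<close>, then for some \<open>i < j\<close> it
  also contains the word with exponent \<open>2n\<^sub>j - n\<^sub>i\<close> (\<open>poly_context_free_power_extrapolation\<close>). This
  is a weak form of Parikh's theorem. Derivations that are annotated with the states of an
  automaton for the words \<open>x\<^sub>1\<^sup>* \<dots> x\<^sub>r\<^sup>*\<close> are compared by the multisets of productions that they use. By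
  Dickson's lemma, some two of them satisfy \<open>\<phi>\<^sub>i \<le> \<phi>\<^sub>j\<close> and involve the same productions. Their difference
  produces every nonterminal as often as it consumes it, and a difference of this kind can be
  inserted into the second derivation once more (\<open>insert_balanced\<close>). As the counting is additive, the
  argument works for several languages after passing to subsequences. Applied to the word problem of
  \<open>\<Gamma>\<^sub>\<tau>\<close> and words representing \<open>a, b, a'\<^sup>-\<^sup>1, b'\<^sup>-\<^sup>1\<close> this contradicts the description of \<open>X\<close>.
\<close>

section \<open>Inserting balanced multisets of productions\<close>

text \<open>A production \<open>\<rho>\<close> rewrites the nonterminal \<open>lhs \<rho>\<close> to the multiset \<open>rhs \<rho>\<close>; the order of symbols and
  the terminals are forgotten. In \<open>fires M \<sigma> N\<close> the multiset \<open>\<sigma>\<close> collects the productions of a derivation.\<close>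

context
  fixes lhs :: "'p \<Rightarrow> 'n" and rhs :: "'p \<Rightarrow> 'n multiset"
begin

inductive fires :: "'n multiset \<Rightarrow> 'p multiset \<Rightarrow> 'n multiset \<Rightarrow> bool" where
  idle: "fires M {#} M"
| fire: "fires (M + rhs \<rho>) \<sigma> N \<Longrightarrow> fires (add_mset (lhs \<rho>) M) (add_mset \<rho> \<sigma>) N"

abbreviation consumed :: "'p multiset \<Rightarrow> 'n multiset" where
  "consumed \<sigma> \<equiv> image_mset lhs \<sigma>"

abbreviation produced :: "'p multiset \<Rightarrow> 'n multiset" where
  "produced \<sigma> \<equiv> \<Sum>\<rho>\<in>#\<sigma>. rhs \<rho>"

lemma fires_frame: "fires M \<sigma> N \<Longrightarrow> fires (M + K) \<sigma> (N + K)"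
  by (induction rule: fires.induct) (auto intro: fires.intros simp: ac_simps)

lemma fires_trans: "fires M \<sigma> N \<Longrightarrow> fires N \<sigma>' K \<Longrightarrow> fires M (\<sigma> + \<sigma>') K"
  by (induction rule: fires.induct) (auto intro: fires.intros)

lemma fires_balance: "fires M \<sigma> N \<Longrightarrow> M + produced \<sigma> = consumed \<sigma> + N"
  by (induction rule: fires.induct) (auto simp: ac_simps)

text \<open>As long as \<open>M\<close> is not contained in \<open>N\<close>, some nonterminal \<open>Y\<close> is more frequent in \<open>M\<close>. The balance
  equation then forces \<open>\<theta>\<close> to consume \<open>Y\<close>, and firing a production for \<open>Y\<close> preserves the equation.\<close>

lemma greedy_firing:
  "M + produced \<theta> = consumed \<theta> + N \<Longrightarrow> \<exists>\<sigma> K. \<sigma> \<subseteq># \<theta> \<and> K \<subseteq># N \<and> fires M \<sigma> K"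
proof (induction "size \<theta>" arbitrary: M \<theta>)
  case 0
  then show ?case using idle[of M] by auto
next
  case (Suc k)
  show ?case
  proof (cases "M \<subseteq># N")
    case True
    then show ?thesis using idle[of M] by (intro exI[of _ "{#}"] exI[of _ M]) auto
  next
    case False
    then obtain Y where "count M Y > count N Y"
      by (auto simp: subseteq_mset_def not_le)
    moreover have "count M Y \<le> count (consumed \<theta>) Y + count N Y"
      using arg_cong[OF Suc.prems, of "\<lambda>A. count A Y"] by simp
    ultimately have "count M Y > 0" "count (consumed \<theta>) Y > 0" by linarith+
    then have "Y \<in># M" "Y \<in># consumed \<theta>" by (simp_all only: count_greater_zero_iff)
    then obtain \<rho> where \<rho>: "\<rho> \<in># \<theta>" "lhs \<rho> \<in># M" by auto
    obtain \<theta>' where \<theta>: "\<theta> = add_mset \<rho> \<theta>'" using \<rho>(1) by (metis insert_DiffM)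
    obtain M' where M: "M = add_mset (lhs \<rho>) M'" using \<rho>(2) by (metis insert_DiffM)
    have "(M' + rhs \<rho>) + produced \<theta>' = consumed \<theta>' + N"
      using Suc.prems by (simp add: \<theta> M ac_simps)
    then obtain \<sigma> K where "\<sigma> \<subseteq># \<theta>'" "K \<subseteq># N" "fires (M' + rhs \<rho>) \<sigma> K"
      using Suc.hyps \<theta> by fastforce
    then show ?thesis
      by (intro exI[of _ "add_mset \<rho> \<sigma>"] exI[of _ K]) (auto simp: \<theta> M intro: fire)
  qed
qed

text \<open>Suppose that no such loop exists and let \<open>\<sigma>\<close> derive a single \<open>Y\<close> completely. What is left of \<open>\<theta>\<close>
  then produces \<open>Y\<close> once more than it consumes it, so it contains a production \<open>\<rho>\<close> with \<open>Y\<close> on its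
  right-hand side. Using \<open>\<rho>\<close> first, \<open>\<sigma>\<close> for that \<open>Y\<close>, and greedy firing for the other symbols yields
  either a loop at \<open>lhs \<rho>\<close> or a complete derivation of \<open>lhs \<rho>\<close> larger than \<open>\<sigma>\<close>. The latter cannot
  continue forever inside \<open>\<theta>\<close>.\<close>

lemma balanced_contains_loop:
  assumes "\<theta> \<noteq> {#}" and balanced: "produced \<theta> = consumed \<theta>"
  shows "\<exists>Y \<sigma>. \<sigma> \<subseteq># \<theta> \<and> \<sigma> \<noteq> {#} \<and> Y \<in># consumed \<theta> \<and> fires {#Y#} \<sigma> {#Y#}"
proof (rule ccontr)
  assume "\<not> ?thesis"
  then have no_loop: "\<And>\<sigma> Y. \<sigma> \<subseteq># \<theta> \<Longrightarrow> \<sigma> \<noteq> {#} \<Longrightarrow> Y \<in># consumed \<theta> \<Longrightarrow> \<not> fires {#Y#} \<sigma> {#Y#}"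
    by blast
  \<comment> \<open>The multiset \<open>A\<close> is \<open>{#Y#}\<close> for a complete derivation \<open>\<sigma>\<close> of \<open>Y\<close>, and empty together with \<open>\<sigma>\<close> at the start.\<close>
  have step: "\<exists>\<sigma>'. \<sigma>' \<subseteq># \<theta> \<and> (\<exists>Y. fires {#Y#} \<sigma>' {#}) \<and> size \<sigma>' > size \<sigma>"
    if \<sigma>: "\<sigma> \<subseteq># \<theta>" "fires A \<sigma> {#}" and \<rho>: "\<rho> \<in># \<theta> - \<sigma>" "A \<subseteq># rhs \<rho>"
      and A: "A + produced \<sigma> = consumed \<sigma>" for A \<sigma> \<rho>
  proof -
    let ?Y = "lhs \<rho>"
    obtain \<theta>' where \<theta>': "\<theta> = \<sigma> + add_mset \<rho> \<theta>'"
      using \<sigma>(1) \<rho>(1) by (metis insert_DiffM subset_mset.add_diff_inverse)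
    obtain B where B: "rhs \<rho> = A + B" using \<rho>(2) by (auto simp: mset_subset_eq_exists_conv)
    have "produced \<sigma> + (A + B + produced \<theta>') = A + produced \<sigma> + (add_mset ?Y (consumed \<theta>'))"
      using balanced by (simp add: \<theta>' B ac_simps flip: A)
    then have "B + produced \<theta>' = consumed \<theta>' + {#?Y#}" by (simp add: ac_simps)
    from greedy_firing[OF this] obtain \<sigma>' K
      where K: "\<sigma>' \<subseteq># \<theta>'" "K \<subseteq># {#?Y#}" "fires B \<sigma>' K" by blast
    let ?\<sigma> = "add_mset \<rho> (\<sigma> + \<sigma>')"
    have "fires (A + B) (\<sigma> + \<sigma>') K"
      using fires_trans[OF fires_frame[OF \<sigma>(2), of B]] K(3) by simp
    then have fires: "fires {#?Y#} ?\<sigma> K" using fire[of "{#}" \<rho>] B by simp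
    have sub: "?\<sigma> \<subseteq># \<theta>" using K(1) by (simp add: \<theta>')
    moreover have "?Y \<in># consumed \<theta>" by (simp add: \<theta>')
    ultimately have "\<not> fires {#?Y#} ?\<sigma> {#?Y#}"
      using no_loop[of ?\<sigma> ?Y] by simp
    moreover have "K = {#} \<or> K = {#?Y#}" using K(2)
      by (metis mset_subset_eq_exists_conv union_is_single)
    ultimately have "fires {#?Y#} ?\<sigma> {#}" using fires by metis
    then show ?thesis using sub by (intro exI[of _ ?\<sigma>]) auto
  qed
  have big: "\<exists>\<sigma>. \<sigma> \<subseteq># \<theta> \<and> (\<exists>Y. fires {#Y#} \<sigma> {#}) \<and> size \<sigma> > n" for n
  proof (induction n)
    case 0
    obtain \<rho> where "\<rho> \<in># \<theta>" using assms(1) by blast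
    then show ?case using step[of "{#}" "{#}" \<rho>] idle[of "{#}"] by auto
  next
    case (Suc n)
    then obtain \<sigma> Y where \<sigma>: "\<sigma> \<subseteq># \<theta>" "fires {#Y#} \<sigma> {#}" "size \<sigma> > n" by blast
    have bal: "{#Y#} + produced \<sigma> = consumed \<sigma>" using fires_balance[OF \<sigma>(2)] by simp
    have "produced \<sigma> + produced (\<theta> - \<sigma>) = consumed \<sigma> + consumed (\<theta> - \<sigma>)"
      using balanced \<sigma>(1) by (metis image_mset_union subset_mset.add_diff_inverse sum_mset.union)
    also have "\<dots> = produced \<sigma> + ({#Y#} + consumed (\<theta> - \<sigma>))"
      by (simp flip: bal)
    finally have "produced (\<theta> - \<sigma>) = {#Y#} + consumed (\<theta> - \<sigma>)" by (simp only: add_left_cancel)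
    then have "Y \<in># produced (\<theta> - \<sigma>)" by simp
    then obtain \<rho> where "\<rho> \<in># \<theta> - \<sigma>" "Y \<in># rhs \<rho>" by auto
    then show ?case using step[OF \<sigma>(1,2) _ _ bal, of \<rho>] \<sigma>(3) by fastforce
  qed
  from big[of "size \<theta>"] show False by (auto dest: size_mset_mono)
qed

text \<open>The loop is run at the first moment at which \<open>Y\<close> is about to be rewritten.\<close>

lemma insert_loop:
  assumes "fires M \<phi> N" "Y \<in># consumed \<phi>" "fires {#Y#} \<sigma> {#Y#}"
  shows "fires M (\<phi> + \<sigma>) N"
  using assms
proof (induction rule: fires.induct)
  case (fire M \<rho> \<phi> N)
  show ?case
  proof (cases "lhs \<rho> = Y")
    case True
    then have "fires (add_mset (lhs \<rho>) M) \<sigma> (add_mset (lhs \<rho>) M)"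
      using fires_frame[OF fire.prems(2), of M] by simp
    from fires_trans[OF this fires.fire[OF fire.hyps]] show ?thesis by (simp add: ac_simps)
  next
    case False
    then show ?thesis using fires.fire[OF fire.IH] fire.prems by simp
  qed
qed simp

text \<open>A balanced multiset is exhausted by splitting off loops, each of which starts at a nonterminal that
  the given derivation already visits.\<close>

lemma insert_balanced:
  assumes "fires M \<phi> N" "produced \<theta> = consumed \<theta>" "set_mset (consumed \<theta>) \<subseteq> set_mset (consumed \<phi>)"
  shows "fires M (\<phi> + \<theta>) N"
  using assms
proof (induction "size \<theta>" arbitrary: \<phi> \<theta> rule: less_induct)
  case less
  show ?case
  proof (cases "\<theta> = {#}")
    case False
    then obtain Y \<sigma> where \<sigma>: "\<sigma> \<subseteq># \<theta>" "\<sigma> \<noteq> {#}" "Y \<in># consumed \<theta>" "fires {#Y#} \<sigma> {#Y#}"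
      using balanced_contains_loop less.prems(2) by blast
    obtain \<theta>' where \<theta>: "\<theta> = \<sigma> + \<theta>'" using \<sigma>(1) by (auto simp: mset_subset_eq_exists_conv)
    have "produced \<sigma> = consumed \<sigma>" using fires_balance[OF \<sigma>(4)] by simp
    then have "produced \<theta>' = consumed \<theta>'" using less.prems(2) by (simp add: \<theta>)
    moreover have "fires M (\<phi> + \<sigma>) N" using insert_loop[OF less.prems(1) _ \<sigma>(4)] \<sigma>(3) less.prems(3) by blast
    ultimately have "fires M (\<phi> + \<sigma> + \<theta>') N"
      using less.prems(3) \<sigma>(2) less.hyps[of \<theta>' "\<phi> + \<sigma>"]
      by (simp add: \<theta> nonempty_has_size le_supI1)
    then show ?thesis by (simp add: \<theta> ac_simps)
  qed (use less.prems in auto)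
qed

end

section \<open>Monotone subsequences\<close>

lemma increasing_subsequence:
  fixes f :: "nat \<Rightarrow> nat"
  shows "\<exists>r :: nat \<Rightarrow> nat. strict_mono r \<and> mono (f \<circ> r)"
proof -
  obtain r where r: "strict_mono r" "monoseq (\<lambda>n. f (r n))" using seq_monosub by blast
  then consider "mono (f \<circ> r)" | "antimono (f \<circ> r)"
    by (auto simp: monoseq_def mono_def antimono_def)
  then show ?thesis
  proof cases
    case 2
    define m where "m = (LEAST v. v \<in> range (f \<circ> r))"
    have "m \<in> range (f \<circ> r)" unfolding m_def by (rule LeastI[of _ "(f \<circ> r) 0"]) simp
    then obtain N where N: "m = f (r N)" by auto
    have "f (r n) = m" if "n \<ge> N" for n
    proof (rule antisym)
      show "f (r n) \<le> m" using 2 that by (auto simp: N antimono_def)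
      show "m \<le> f (r n)" unfolding m_def by (rule Least_le) auto
    qed
    then have "mono (f \<circ> (\<lambda>n. r (n + N)))" by (simp add: mono_def)
    moreover have "strict_mono (\<lambda>n. r (n + N))" using r(1) by (simp add: strict_mono_def)
    ultimately show ?thesis by blast
  qed (use r in blast)
qed

text \<open>Dickson's lemma for finitely many coordinates, in the form of a subsequence that is monotone in each.\<close>

lemma simultaneously_increasing_subsequence:
  fixes f :: "nat \<Rightarrow> 'i \<Rightarrow> nat"
  assumes "finite I"
  shows "\<exists>r :: nat \<Rightarrow> nat. strict_mono r \<and> (\<forall>i\<in>I. mono (\<lambda>n. f (r n) i))"
  using assms
proof induction
  case empty
  show ?case by (intro exI[of _ id]) (simp add: strict_mono_def)
next
  case (insert x I)
  then obtain r :: "nat \<Rightarrow> nat" where r: "strict_mono r" "\<forall>i\<in>I. mono (\<lambda>n. f (r n) i)" by blast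
  obtain g :: "nat \<Rightarrow> nat" where g: "strict_mono g" "mono ((\<lambda>n. f (r n) x) \<circ> g)" using increasing_subsequence by blast
  have "mono (\<lambda>n. f (r (g n)) i)" if "i \<in> I" for i
    using r(2) g(1) that by (simp add: mono_def strict_mono_less_eq)
  then show ?case using g(2) strict_mono_o[OF r(1) g(1)]
    by (intro exI[of _ "r \<circ> g"]) (auto simp: o_def)
qed

section \<open>Extrapolation in context-free languages\<close>

text \<open>The edges of a path carry terminals, or symbols of a sentential form. The latter describe how a
  sentential form could be read by an automaton if a nonterminal \<open>A\<close> between the states \<open>a\<close> and \<open>b\<close>
  stood for a word that leads from \<open>a\<close> to \<open>b\<close>.\<close>

fun path :: "'q \<Rightarrow> ('q \<times> 'x \<times> 'q) list \<Rightarrow> 'q \<Rightarrow> bool" where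
  "path s [] f \<longleftrightarrow> s = f"
| "path s ((a, x, b) # es) f \<longleftrightarrow> s = a \<and> path b es f"

definition labels :: "('q \<times> 'x \<times> 'q) list \<Rightarrow> 'x list" where
  "labels = map (\<lambda>e. fst (snd e))"

lemma labels_simps [simp]:
  "labels [] = []"
  "labels (e # es) = fst (snd e) # labels es"
  "labels (es @ fs) = labels es @ labels fs"
  "length (labels es) = length es"
  by (simp_all add: labels_def)

lemma labels_eq_append:
  "labels es = u @ v \<Longrightarrow> \<exists>es1 es2. es = es1 @ es2 \<and> labels es1 = u \<and> labels es2 = v"
  unfolding labels_def map_eq_append_conv by blast

lemma path_append: "path s (es @ fs) f \<longleftrightarrow> (\<exists>m. path s es m \<and> path m fs f)"
  by (induction s es f rule: path.induct) auto

lemma path_state_mem: "path s es f \<Longrightarrow> s \<in> Q \<Longrightarrow> set es \<subseteq> Q \<times> UNIV \<times> Q \<Longrightarrow> f \<in> Q"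
  by (induction s es f rule: path.induct) auto

fun nonterminal_edges :: "('q \<times> ('n + 't) \<times> 'q) list \<Rightarrow> ('q \<times> 'n \<times> 'q) multiset" where
  "nonterminal_edges [] = {#}"
| "nonterminal_edges ((a, Inl A, b) # es) = add_mset (a, A, b) (nonterminal_edges es)"
| "nonterminal_edges ((a, Inr x, b) # es) = nonterminal_edges es"

fun terminal_edges :: "('q \<times> ('n + 't) \<times> 'q) list \<Rightarrow> ('q \<times> 't \<times> 'q) multiset" where
  "terminal_edges [] = {#}"
| "terminal_edges ((a, Inl A, b) # es) = terminal_edges es"
| "terminal_edges ((a, Inr x, b) # es) = add_mset (a, x, b) (terminal_edges es)"

lemma nonterminal_edges_append [simp]:
  "nonterminal_edges (es @ fs) = nonterminal_edges es + nonterminal_edges fs"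
  by (induction es rule: nonterminal_edges.induct) auto

lemma terminal_edges_append [simp]:
  "terminal_edges (es @ fs) = terminal_edges es + terminal_edges fs"
  by (induction es rule: terminal_edges.induct) auto

lemma nonterminal_edges_memD:
  "(a, A, b) \<in># nonterminal_edges es \<Longrightarrow> (a, Inl A, b) \<in> set es"
  by (induction es rule: nonterminal_edges.induct) auto

fun terminal_path :: "('q \<times> 't \<times> 'q) list \<Rightarrow> ('q \<times> ('n + 't) \<times> 'q) list" where
  "terminal_path [] = []"
| "terminal_path ((a, x, b) # \<pi>) = (a, Inr x, b) # terminal_path \<pi>"

lemma terminal_path_props [simp]:
  "path s (terminal_path \<pi>) f \<longleftrightarrow> path s \<pi> f"
  "labels (terminal_path \<pi>) = map Inr (labels \<pi>)"
  "nonterminal_edges (terminal_path \<pi>) = {#}"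
  "terminal_edges (terminal_path \<pi>) = mset \<pi>"
  "set (terminal_path \<pi>) \<subseteq> Q \<times> UNIV \<times> Q \<longleftrightarrow> set \<pi> \<subseteq> Q \<times> UNIV \<times> Q"
  by (induction s \<pi> f rule: path.induct) auto

lemma terminal_path_exists:
  "nonterminal_edges es = {#} \<Longrightarrow> \<exists>\<pi>. es = terminal_path \<pi>"
proof (induction es rule: nonterminal_edges.induct)
  case (3 a x b es)
  then obtain \<pi> where "es = terminal_path \<pi>" by auto
  then show ?case by (intro exI[of _ "(a, x, b) # \<pi>"]) simp
qed (auto intro: exI[of _ "[]"])

text \<open>The triple \<open>(a, A, b)\<close> is the annotated left-hand side, the path is the annotated right-hand side.\<close>

type_synonym ('q, 'n, 't) annotated_production =
  "('q \<times> 'n \<times> 'q) \<times> ('q \<times> ('n + 't) \<times> 'q) list"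

definition annotated_productions ::
    "('n, 't) grammar \<Rightarrow> 'q set \<Rightarrow> ('q, 'n, 't) annotated_production set" where
  "annotated_productions \<G> Q = {((a, A, b), es) | a A b es.
     (A, labels es) \<in> snd \<G> \<and> path a es b \<and> a \<in> Q \<and> b \<in> Q \<and> set es \<subseteq> Q \<times> UNIV \<times> Q}"

abbreviation annotated_fires where
  "annotated_fires \<equiv> fires fst (\<lambda>\<rho>. nonterminal_edges (snd \<rho>))"

lemma finite_annotated_productions:
  fixes \<G> :: "('n, 't) grammar" and Q :: "'q set"
  assumes "finite (snd \<G>)" "finite Q"
  shows "finite (annotated_productions \<G> Q)"
proof -
  define X where "X = (\<lambda>v. {es :: ('q \<times> ('n + 't) \<times> 'q) list. set es \<subseteq> Q \<times> set v \<times> Q \<and> length es = length v})"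
  have "annotated_productions \<G> Q \<subseteq> (\<Union>(A, v) \<in> snd \<G>. (Q \<times> {A} \<times> Q) \<times> X v)"
  proof
    fix \<rho> assume "\<rho> \<in> annotated_productions \<G> Q"
    then obtain a A b es where \<rho>: "\<rho> = ((a, A, b), es)" "(A, labels es) \<in> snd \<G>" "a \<in> Q" "b \<in> Q"
        "set es \<subseteq> Q \<times> UNIV \<times> Q"
      unfolding annotated_productions_def by blast
    have "es \<in> X (labels es)"
      using \<rho>(5) unfolding X_def by (force simp: labels_def)
    then show "\<rho> \<in> (\<Union>(A, v) \<in> snd \<G>. (Q \<times> {A} \<times> Q) \<times> X v)"
      using \<rho> by (intro UN_I[of "(A, labels es)"]) auto
  qed
  moreover have "finite (X v)" for v
    unfolding X_def by (rule finite_lists_length_eq) (simp add: assms)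
  ultimately show ?thesis
    using assms by (elim finite_subset) auto
qed

text \<open>Going backwards through the derivation, the states along the part of the path that a production has
  created become the annotation of that production.\<close>

lemma annotate_derivation:
  assumes "(derives1 \<G>)\<^sup>*\<^sup>* u (map Inr (labels \<pi>))" "path s \<pi> f" "s \<in> Q" "set \<pi> \<subseteq> Q \<times> UNIV \<times> Q"
  shows "\<exists>es \<phi>. labels es = u \<and> path s es f \<and> set es \<subseteq> Q \<times> UNIV \<times> Q \<and>
    set_mset \<phi> \<subseteq> annotated_productions \<G> Q \<and> annotated_fires (nonterminal_edges es) \<phi> {#} \<and>
    mset \<pi> = terminal_edges es + (\<Sum>\<rho>\<in>#\<phi>. terminal_edges (snd \<rho>))"
  using assms(1)
proof (induction rule: converse_rtranclp_induct)
  case base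
  show ?case
    by (intro exI[of _ "terminal_path \<pi>"] exI[of _ "{#}"])
      (use assms in \<open>auto intro: fires.idle\<close>)
next
  case (step u u')
  then obtain es \<phi> where IH: "labels es = u'" "path s es f" "set es \<subseteq> Q \<times> UNIV \<times> Q"
      "set_mset \<phi> \<subseteq> annotated_productions \<G> Q" "annotated_fires (nonterminal_edges es) \<phi> {#}"
      "mset \<pi> = terminal_edges es + (\<Sum>\<rho>\<in>#\<phi>. terminal_edges (snd \<rho>))" by blast
  from \<open>derives1 \<G> u u'\<close> obtain A v x y where
    u: "u = x @ [Inl A] @ y" "u' = x @ v @ y" "(A, v) \<in> snd \<G>" by (auto elim: derives1.cases)
  obtain es1 es2 es3 where es: "es = es1 @ es2 @ es3" "labels es1 = x" "labels es2 = v" "labels es3 = y"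
    using IH(1) labels_eq_append[of es x "v @ y"] labels_eq_append[of _ v y] unfolding u(2) by metis
  then obtain a b where p: "path s es1 a" "path a es2 b" "path b es3 f"
    using IH(2) by (auto simp: path_append)
  have ab: "a \<in> Q" "b \<in> Q"
    using path_state_mem[OF p(1)] path_state_mem[OF p(2)] assms(3) IH(3) es(1) by auto
  let ?\<rho> = "((a, A, b), es2)" and ?es = "es1 @ [(a, Inl A, b)] @ es3"
  have "?\<rho> \<in> annotated_productions \<G> Q"
    unfolding annotated_productions_def using u(3) es p ab IH(3) by auto
  moreover have "annotated_fires (nonterminal_edges ?es) (add_mset ?\<rho> \<phi>) {#}"
    using fires.fire[of fst "\<lambda>\<rho>. nonterminal_edges (snd \<rho>)"
      "nonterminal_edges es1 + nonterminal_edges es3" ?\<rho> \<phi> "{#}"] IH(5)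
    by (simp add: es(1) ac_simps)
  moreover have "path s ?es f" using p by (auto simp: path_append)
  ultimately show ?case
    using IH es u ab by (intro exI[of _ ?es] exI[of _ "add_mset ?\<rho> \<phi>"]) (auto simp: ac_simps)
qed

text \<open>Annotated nonterminals remember their end points. So the productions of a commutative derivation
  can be carried out at actual positions of a path, and only the multiset of the terminal edges of
  the resulting path is prescribed.\<close>

lemma derivation_of_annotated:
  assumes "annotated_fires M \<phi> N" "N = {#}" "M = nonterminal_edges es"
    "set_mset \<phi> \<subseteq> annotated_productions \<G> Q" "path s es f"
  shows "\<exists>\<pi>. path s \<pi> f \<and> (derives1 \<G>)\<^sup>*\<^sup>* (labels es) (map Inr (labels \<pi>)) \<and>
    mset \<pi> = terminal_edges es + (\<Sum>\<rho>\<in>#\<phi>. terminal_edges (snd \<rho>))"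
  using assms
proof (induction arbitrary: es rule: fires.induct)
  case (idle M)
  then obtain \<pi> where "es = terminal_path \<pi>" using terminal_path_exists[of es] by auto
  then show ?case using idle by (intro exI[of _ \<pi>]) auto
next
  case (fire M \<rho> \<phi> N)
  obtain a A b fs where \<rho>: "\<rho> = ((a, A, b), fs)" by (metis surj_pair)
  have "(a, A, b) \<in># nonterminal_edges es" using fire.prems(2) by (simp add: \<rho> flip: fire.prems(2))
  then obtain es1 es3 where es: "es = es1 @ (a, Inl A, b) # es3"
    by (meson nonterminal_edges_memD split_list)
  have R: "(A, labels fs) \<in> snd \<G>" "path a fs b"
    using fire.prems(3) by (auto simp: \<rho> annotated_productions_def)
  let ?es = "es1 @ fs @ es3"
  have "path s ?es f" using fire.prems(4) R(2) by (auto simp: es path_append)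
  moreover have "M + nonterminal_edges (snd \<rho>) = nonterminal_edges ?es"
    using fire.prems(2) by (simp add: \<rho> es)
  ultimately obtain \<pi> where \<pi>: "path s \<pi> f" "(derives1 \<G>)\<^sup>*\<^sup>* (labels ?es) (map Inr (labels \<pi>))"
      "mset \<pi> = terminal_edges ?es + (\<Sum>\<rho>\<in>#\<phi>. terminal_edges (snd \<rho>))"
    using fire.IH[of ?es] fire.prems by auto
  have "derives1 \<G> (labels es) (labels ?es)"
    using derives1.intros[OF R(1), of "labels es1" "labels es3"] by (simp add: es)
  with \<pi> show ?case by (intro exI[of _ \<pi>]) (auto simp: es \<rho> intro: converse_rtranclp_into_rtranclp)
qed

text \<open>Two derivations whose production multisets are comparable and have the same support are
  extrapolated by adding their difference \<open>\<theta>\<close> to the larger one. The terminal edges depend additively on the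
  productions, hence the equation between the edge multisets.\<close>

lemma context_free_extrapolation:
  fixes \<pi> :: "nat \<Rightarrow> ('q \<times> 't \<times> 'q) list"
  assumes "context_free \<Sigma> L" "finite Q" "s \<in> Q" "\<And>n. path s (\<pi> n) f"
    "\<And>n. set (\<pi> n) \<subseteq> Q \<times> UNIV \<times> Q" "\<And>n. labels (\<pi> n) \<in> L"
  shows "\<exists>r :: nat \<Rightarrow> nat. strict_mono r \<and> (\<forall>i j. i < j \<longrightarrow> (\<exists>\<pi>'. path s \<pi>' f \<and> labels \<pi>' \<in> L \<and>
    mset \<pi>' + mset (\<pi> (r i)) = mset (\<pi> (r j)) + mset (\<pi> (r j))))"
proof -
  obtain \<G> :: "(nat, 't) grammar" where \<G>: "finite (snd \<G>)" "L = grammar_language \<G>"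
    using assms(1) by (auto simp: context_free_def context_free_grammar_over_def)
  let ?P = "annotated_productions \<G> Q" and ?start = "(s, fst \<G>, f)"
  let ?w = "\<lambda>\<phi>. \<Sum>\<rho>\<in>#\<phi>. terminal_edges (snd \<rho>)"
  have finP: "finite ?P" by (rule finite_annotated_productions) fact+
  have "\<exists>\<phi>. set_mset \<phi> \<subseteq> ?P \<and> annotated_fires {#?start#} \<phi> {#} \<and> mset (\<pi> n) = ?w \<phi>" for n
  proof -
    have "(derives1 \<G>)\<^sup>*\<^sup>* [Inl (fst \<G>)] (map Inr (labels (\<pi> n)))"
      using assms(6)[of n] by (simp add: \<G>(2) grammar_language_def)
    from annotate_derivation[OF this assms(4,3,5)] obtain es \<phi> where
      es: "labels es = [Inl (fst \<G>)]" "path s es f" "set_mset \<phi> \<subseteq> ?P"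
        "annotated_fires (nonterminal_edges es) \<phi> {#}" "mset (\<pi> n) = terminal_edges es + ?w \<phi>" by blast
    then have "es = [(s, Inl (fst \<G>), f)]" by (auto simp: labels_def)
    then show ?thesis using es by auto
  qed
  then obtain \<phi> where \<phi>: "\<And>n. set_mset (\<phi> n) \<subseteq> ?P" "\<And>n. annotated_fires {#?start#} (\<phi> n) {#}"
      "\<And>n. mset (\<pi> n) = ?w (\<phi> n)" by metis
  \<comment> \<open>The coordinate \<open>(\<rho>, False)\<close> indicates that \<open>\<rho>\<close> is absent. Monotonicity of both coordinates makes the
    supports of the production multisets equal along the subsequence.\<close>
  obtain r :: "nat \<Rightarrow> nat" where r: "strict_mono r" and mono_r:
      "\<forall>i\<in>?P \<times> UNIV. mono (\<lambda>n. (\<lambda>(\<rho>, b). if b then count (\<phi> (r n)) \<rho> else of_bool (\<rho> \<notin># \<phi> (r n))) i)"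
    using simultaneously_increasing_subsequence[OF finite_cartesian_product[OF finP finite[of UNIV]],
      where f = "\<lambda>n (\<rho>, b). if b then count (\<phi> n) \<rho> else of_bool (\<rho> \<notin># \<phi> n)"]
    by (elim exE conjE)
  have mono_count: "count (\<phi> (r i)) \<rho> \<le> count (\<phi> (r j)) \<rho>" if "\<rho> \<in> ?P" "i \<le> j" for \<rho> i j
    using bspec[OF mono_r, of "(\<rho>, True)"] that by (simp add: mono_def)
  have mono_absent: "\<rho> \<notin># \<phi> (r j)" if "\<rho> \<in> ?P" "i \<le> j" "\<rho> \<notin># \<phi> (r i)" for \<rho> i j
    using bspec[OF mono_r, of "(\<rho>, False)"] that(1) monoD[OF _ that(2)] that(3) by fastforce
  have "\<exists>\<pi>'. path s \<pi>' f \<and> labels \<pi>' \<in> L \<and>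
      mset \<pi>' + mset (\<pi> (r i)) = mset (\<pi> (r j)) + mset (\<pi> (r j))" if "i < j" for i j
  proof -
    have "count (\<phi> (r i)) \<rho> \<le> count (\<phi> (r j)) \<rho>" for \<rho>
      using mono_count[of \<rho> i j] \<phi>(1)[of "r i"] that
      by (cases "\<rho> \<in># \<phi> (r i)") (auto simp: not_in_iff)
    then obtain \<theta> where \<theta>: "\<phi> (r j) = \<phi> (r i) + \<theta>"
      by (metis mset_subset_eqI mset_subset_eq_exists_conv)
    have "set_mset (\<phi> (r j)) \<subseteq> set_mset (\<phi> (r i))"
      using mono_absent[of _ i j] \<phi>(1)[of "r j"] that by (meson less_imp_le subset_iff)
    then have supp: "fst ` set_mset \<theta> \<subseteq> fst ` set_mset (\<phi> (r i))" by (auto simp: \<theta>)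
    let ?rhs = "\<lambda>\<sigma>. \<Sum>\<rho>\<in>#\<sigma>. nonterminal_edges (snd \<rho>)"
    have "{#?start#} + ?rhs (\<phi> (r i)) + ?rhs \<theta> = image_mset fst (\<phi> (r i)) + image_mset fst \<theta>"
      using fires_balance[OF \<phi>(2)[of "r j"]] by (simp add: \<theta>)
    moreover have "{#?start#} + ?rhs (\<phi> (r i)) = image_mset fst (\<phi> (r i))"
      using fires_balance[OF \<phi>(2)[of "r i"]] by simp
    ultimately have "?rhs \<theta> = image_mset fst \<theta>" by (simp only: add_left_cancel)
    then have fires: "annotated_fires {#?start#} (\<phi> (r j) + \<theta>) {#}"
      by (rule insert_balanced[OF \<phi>(2)]) (auto simp: \<theta>)
    have "set_mset (\<phi> (r j) + \<theta>) \<subseteq> ?P" using \<phi>(1)[of "r j"] by (auto simp: \<theta>)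
    then have "\<exists>\<pi>'. path s \<pi>' f \<and> (derives1 \<G>)\<^sup>*\<^sup>* (labels [(s, Inl (fst \<G>), f)]) (map Inr (labels \<pi>')) \<and>
        mset \<pi>' = terminal_edges [(s, Inl (fst \<G>), f)] + ?w (\<phi> (r j) + \<theta>)"
      by (intro derivation_of_annotated[OF fires]) auto
    then obtain \<pi>' where \<pi>': "path s \<pi>' f" "(derives1 \<G>)\<^sup>*\<^sup>* [Inl (fst \<G>)] (map Inr (labels \<pi>'))"
        "mset \<pi>' = ?w (\<phi> (r j) + \<theta>)" by auto
    then show ?thesis
      by (intro exI[of _ \<pi>']) (auto simp: \<G>(2) grammar_language_def \<phi>(3) \<theta> ac_simps)
  qed
  with r show ?thesis by blast
qed

section \<open>Words of the form \<open>x\<^sub>1\<^sup>n \<dots> x\<^sub>r\<^sup>n\<close>\<close>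

text \<open>The state \<open>(k, i)\<close> means that \<open>i\<close> letters of the \<open>k\<close>-th word have been read in the current lap. The last letter
  leads either to a new lap of the same word or to the next word. So every word
  is passed at least once, which makes transitions without a letter superfluous.\<close>

definition lap_edges :: "'t list list \<Rightarrow> ((nat \<times> nat) \<times> 't \<times> (nat \<times> nat)) set" where
  "lap_edges xs = {((k, i), xs ! k ! i, s) | k i s. k < length xs \<and> i < length (xs ! k) \<and>
     s \<in> (if Suc i < length (xs ! k) then {(k, Suc i)} else {(k, 0), (Suc k, 0)})}"

text \<open>A lap is counted at its last letter; so a path that starts in the middle of a word is credited with
  the whole lap.\<close>

definition laps :: "'t list list \<Rightarrow> nat \<Rightarrow> ((nat \<times> nat) \<times> 't \<times> (nat \<times> nat)) multiset \<Rightarrow> nat" where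
  "laps xs k M = size {#e \<in># M. fst e = (k, length (xs ! k) - 1)#}"

definition power_words :: "'t list list \<Rightarrow> nat \<Rightarrow> (nat \<Rightarrow> nat) \<Rightarrow> 't list" where
  "power_words xs k c = concat (map (\<lambda>j. concat (replicate (c j) (xs ! j))) [k..<length xs])"

lemma laps_simps [simp]:
  "laps xs k {#} = 0"
  "laps xs k (M + N) = laps xs k M + laps xs k N"
  "laps xs k (add_mset e M) = of_bool (fst e = (k, length (xs ! k) - 1)) + laps xs k M"
  by (simp_all add: laps_def)

text \<open>The number of laps for each word determines the word that is read. Prefixing the letters already
  read in the current lap makes the claim invariant under single edges.\<close>

lemma labels_of_lap_path:
  assumes "path (k, i) \<pi> (length xs, 0)" "set \<pi> \<subseteq> lap_edges xs"
  shows "take i (xs ! k) @ labels \<pi> = power_words xs k (\<lambda>j. laps xs j (mset \<pi>)) \<and>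
    (\<forall>j<k. laps xs j (mset \<pi>) = 0)"
  using assms
proof (induction \<pi> arbitrary: k i)
  case Nil
  then show ?case by (simp add: power_words_def)
next
  case (Cons e \<pi>)
  obtain s where e: "e = ((k, i), xs ! k ! i, s)" and k: "k < length xs" and i: "i < length (xs ! k)"
      and s: "s \<in> (if Suc i < length (xs ! k) then {(k, Suc i)} else {(k, 0), (Suc k, 0)})"
    using Cons.prems by (cases e) (auto simp: lap_edges_def)
  have p: "path s \<pi> (length xs, 0)" "set \<pi> \<subseteq> lap_edges xs" using Cons.prems by (auto simp: e)
  show ?case
  proof (cases "Suc i < length (xs ! k)")
    case True
    then have lap: "laps xs j (mset (e # \<pi>)) = laps xs j (mset \<pi>)" for j by (auto simp: e)
    have "take i (xs ! k) @ labels (e # \<pi>) = take (Suc i) (xs ! k) @ labels \<pi>"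
      using i by (simp add: e take_Suc_conv_app_nth)
    then show ?thesis using Cons.IH[of k "Suc i"] p s True by (simp only: lap) simp
  next
    case False
    then have last: "Suc i = length (xs ! k)" using i by simp
    have lap: "laps xs j (mset (e # \<pi>)) = (if j = k then Suc (laps xs j (mset \<pi>)) else laps xs j (mset \<pi>))" for j
      using last by (auto simp: e)
    have word: "take i (xs ! k) @ labels (e # \<pi>) = xs ! k @ labels \<pi>"
      using last i by (simp add: e flip: take_Suc_conv_app_nth)
    have unfold: "power_words xs k c = concat (replicate (c k) (xs ! k)) @ power_words xs (Suc k) c" for c
      using k by (simp add: power_words_def upt_conv_Cons)
    have rest: "power_words xs (Suc k)
          (\<lambda>j. if j = k then Suc (laps xs j (mset \<pi>)) else laps xs j (mset \<pi>)) =
        power_words xs (Suc k) (\<lambda>j. laps xs j (mset \<pi>))"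
      unfolding power_words_def by (intro arg_cong[of _ _ concat] map_cong) auto
    consider "s = (k, 0)" | "s = (Suc k, 0)" using s False by auto
    then show ?thesis
    proof cases
      case 1
      then show ?thesis using Cons.IH[of k 0] p by (simp add: word rest lap unfold del: mset.simps labels_simps(2))
    next
      case 2
      then show ?thesis using Cons.IH[of "Suc k" 0] p by (simp add: word rest lap unfold del: mset.simps labels_simps(2))
    qed
  qed
qed

lemma single_lap:
  assumes "k < length xs" "i < length (xs ! k)" "s \<in> {(k, 0), (Suc k, 0)}"
  shows "\<exists>\<pi>. path (k, i) \<pi> s \<and> set \<pi> \<subseteq> lap_edges xs \<and> (\<forall>j. laps xs j (mset \<pi>) = of_bool (j = k))"
  using assms(2)
proof (induction "length (xs ! k) - i" arbitrary: i)
  case (Suc m)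
  show ?case
  proof (cases "Suc i < length (xs ! k)")
    case True
    moreover have "m = length (xs ! k) - Suc i" using Suc.hyps(2) by simp
    ultimately obtain \<pi> where "path (k, Suc i) \<pi> s" "set \<pi> \<subseteq> lap_edges xs" "\<forall>j. laps xs j (mset \<pi>) = of_bool (j = k)"
      using Suc.hyps(1)[of "Suc i"] by auto
    then show ?thesis using True assms(1)
      by (intro exI[of _ "((k, i), xs ! k ! i, (k, Suc i)) # \<pi>"]) (auto simp: lap_edges_def)
  next
    case False
    then show ?thesis using Suc.prems assms(1,3)
      by (intro exI[of _ "[((k, i), xs ! k ! i, s)]"]) (auto simp: lap_edges_def)
  qed
qed simp

lemma several_laps:
  assumes "k < length xs" "xs ! k \<noteq> []"
  shows "\<exists>\<pi>. path (k, 0) \<pi> (Suc k, 0) \<and> set \<pi> \<subseteq> lap_edges xs \<and>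
    (\<forall>j. laps xs j (mset \<pi>) = Suc n * of_bool (j = k))"
proof (induction n)
  case 0
  show ?case using single_lap[OF assms(1), of 0 "(Suc k, 0)"] assms(2) by simp
next
  case (Suc n)
  obtain \<pi> where "path (k, 0) \<pi> (k, 0)" "set \<pi> \<subseteq> lap_edges xs" "\<forall>j. laps xs j (mset \<pi>) = of_bool (j = k)"
    using single_lap[OF assms(1), of 0 "(k, 0)"] assms(2) by auto
  moreover obtain \<pi>' where "path (k, 0) \<pi>' (Suc k, 0)" "set \<pi>' \<subseteq> lap_edges xs"
      "\<forall>j. laps xs j (mset \<pi>') = Suc n * of_bool (j = k)"
    using Suc.IH by blast
  ultimately show ?case by (intro exI[of _ "\<pi> @ \<pi>'"]) (auto simp: path_append)
qed

lemma lap_path_exists: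
  assumes "[] \<notin> set xs" "n \<ge> 1" "k \<le> length xs"
  shows "\<exists>\<pi>. path (k, 0) \<pi> (length xs, 0) \<and> set \<pi> \<subseteq> lap_edges xs \<and>
    (\<forall>j. laps xs j (mset \<pi>) = n * of_bool (k \<le> j \<and> j < length xs))"
  using assms(3)
proof (induction rule: inc_induct)
  case base
  show ?case by (intro exI[of _ "[]"]) auto
next
  case (step k)
  have "xs ! k \<noteq> []" using step(2) assms(1) by (metis nth_mem)
  from several_laps[OF step(2) this, of "n - 1"] obtain \<pi> where
    "path (k, 0) \<pi> (Suc k, 0)" "set \<pi> \<subseteq> lap_edges xs" "\<forall>j. laps xs j (mset \<pi>) = n * of_bool (j = k)"
    using assms(2) by auto
  moreover from step.IH obtain \<pi>' where "path (Suc k, 0) \<pi>' (length xs, 0)" "set \<pi>' \<subseteq> lap_edges xs"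
    "\<forall>j. laps xs j (mset \<pi>') = n * of_bool (Suc k \<le> j \<and> j < length xs)" by blast
  ultimately show ?case using step(2)
    by (intro exI[of _ "\<pi> @ \<pi>'"]) (auto simp: path_append of_bool_def)
qed

definition power_word :: "'t list list \<Rightarrow> nat \<Rightarrow> 't list" where
  "power_word xs n = concat (map (\<lambda>x. concat (replicate n x)) xs)"

lemma power_words_const:
  assumes "\<And>j. j < length xs \<Longrightarrow> c j = n"
  shows "power_words xs 0 c = power_word xs n"
proof -
  have "map (\<lambda>j. concat (replicate (c j) (xs ! j))) [0..<length xs] =
      map (\<lambda>x. concat (replicate n x)) (map ((!) xs) [0..<length xs])"
    using assms by simp
  then show ?thesis by (simp only: power_words_def power_word_def map_nth)
qed

text \<open>The paths with \<open>n i\<close> laps of every word are extrapolated. Numbers of laps are additive in the multiset of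
  edges, so the new path makes \<open>2 * n j - n i\<close> laps of every word.\<close>

lemma context_free_power_extrapolation:
  fixes n :: "nat \<Rightarrow> nat"
  assumes "context_free \<Sigma> L" "[] \<notin> set xs" "\<And>i. n i \<ge> 1" "\<And>i. power_word xs (n i) \<in> L"
  shows "\<exists>r :: nat \<Rightarrow> nat. strict_mono r \<and> (\<forall>i j. i < j \<longrightarrow> power_word xs (2 * n (r j) - n (r i)) \<in> L)"
proof -
  let ?Q = "{..length xs} \<times> {..sum_list (map length xs)}" and ?f = "(length xs, 0 :: nat)"
  have le: "length (xs ! k) \<le> sum_list (map length xs)" if "k < length xs" for k
    using that by (intro member_le_sum_list) auto
  have edges: "lap_edges xs \<subseteq> ?Q \<times> UNIV \<times> ?Q"
    using le by (fastforce simp: lap_edges_def split: if_splits)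
  have label: "labels \<pi> = power_word xs m"
    if "path (0, 0) \<pi> ?f" "set \<pi> \<subseteq> lap_edges xs" "\<And>j. j < length xs \<Longrightarrow> laps xs j (mset \<pi>) = m" for \<pi> m
    using labels_of_lap_path[OF that(1,2)] power_words_const[of xs "\<lambda>j. laps xs j (mset \<pi>)" m] that(3) by simp
  have "\<exists>\<pi>. path (0, 0) \<pi> ?f \<and> set \<pi> \<subseteq> lap_edges xs \<and> (\<forall>j<length xs. laps xs j (mset \<pi>) = n i)" for i
    using lap_path_exists[OF assms(2) assms(3)[of i], of 0] by auto
  then obtain \<pi> where \<pi>: "\<And>i. path (0, 0) (\<pi> i) ?f" "\<And>i. set (\<pi> i) \<subseteq> lap_edges xs"
      "\<And>i j. j < length xs \<Longrightarrow> laps xs j (mset (\<pi> i)) = n i" by metis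
  have "labels (\<pi> i) \<in> L" for i using label[OF \<pi>] assms(4) by simp
  moreover have "set (\<pi> i) \<subseteq> ?Q \<times> UNIV \<times> ?Q" for i using \<pi>(2)[of i] edges by blast
  ultimately obtain r :: "nat \<Rightarrow> nat" where r: "strict_mono r" and
      extrapolate: "\<And>i j. i < j \<Longrightarrow> \<exists>\<pi>'. path (0, 0) \<pi>' ?f \<and> labels \<pi>' \<in> L \<and>
        mset \<pi>' + mset (\<pi> (r i)) = mset (\<pi> (r j)) + mset (\<pi> (r j))"
    using context_free_extrapolation[OF assms(1), of ?Q "(0, 0)" \<pi> ?f] \<pi>(1) by auto
  have "power_word xs (2 * n (r j) - n (r i)) \<in> L" if ij: "i < j" for i j
  proof -
    obtain \<pi>' where \<pi>': "path (0, 0) \<pi>' ?f" "labels \<pi>' \<in> L"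
        "mset \<pi>' + mset (\<pi> (r i)) = mset (\<pi> (r j)) + mset (\<pi> (r j))" using extrapolate[OF ij] by blast
    have "set \<pi>' \<subseteq> set (\<pi> (r j))"
      using arg_cong[OF \<pi>'(3), of set_mset] by auto
    then have "set \<pi>' \<subseteq> lap_edges xs" using \<pi>(2) by blast
    moreover have "laps xs k (mset \<pi>') = 2 * n (r j) - n (r i)" if "k < length xs" for k
      using arg_cong[OF \<pi>'(3), of "laps xs k"] \<pi>(3)[OF that] by simp
    ultimately show ?thesis using label[OF \<pi>'(1)] \<pi>'(2) by metis
  qed
  with r show ?thesis by blast
qed

text \<open>A subsequence that serves one language is thinned out further for the next one.\<close>

lemma poly_context_free_power_extrapolation:
  fixes n :: "nat \<Rightarrow> nat"
  assumes "poly_context_free \<Sigma> L" "[] \<notin> set xs" "\<And>i. n i \<ge> 1" "\<And>i. power_word xs (n i) \<in> L"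
  shows "\<exists>i j. i < j \<and> power_word xs (2 * n j - n i) \<in> L"
proof -
  obtain \<L> where \<L>: "finite \<L>" "\<forall>L' \<in> \<L>. context_free \<Sigma> L'" "L = \<Inter>\<L>"
    using assms(1) by (auto simp: poly_context_free_def)
  have "\<exists>r :: nat \<Rightarrow> nat. strict_mono r \<and>
      (\<forall>L'\<in>\<F>. \<forall>i j. i < j \<longrightarrow> power_word xs (2 * n (r j) - n (r i)) \<in> L')" if "\<F> \<subseteq> \<L>" for \<F>
    using finite_subset[OF that \<L>(1)] that
  proof induction
    case empty
    show ?case by (intro exI[of _ id]) (simp add: strict_mono_def)
  next
    case (insert L' \<F>)
    then obtain r :: "nat \<Rightarrow> nat" where r: "strict_mono r"
        "\<forall>L'\<in>\<F>. \<forall>i j. i < j \<longrightarrow> power_word xs (2 * n (r j) - n (r i)) \<in> L'" by auto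
    obtain g :: "nat \<Rightarrow> nat" where g: "strict_mono g"
        "\<forall>i j. i < j \<longrightarrow> power_word xs (2 * n (r (g j)) - n (r (g i))) \<in> L'"
      using context_free_power_extrapolation[of \<Sigma> L' xs "\<lambda>i. n (r i)"] \<L>(2,3) insert.prems assms(2-4) by auto
    show ?case using g(2) r(2) g(1) strict_mono_o[OF r(1) g(1)]
      by (intro exI[of _ "r \<circ> g"]) (auto simp: strict_mono_less o_def)
  qed
  from this[OF order_refl] obtain r :: "nat \<Rightarrow> nat" where "strict_mono r"
      "\<forall>L'\<in>\<L>. \<forall>i j. i < j \<longrightarrow> power_word xs (2 * n (r j) - n (r i)) \<in> L'" by blast
  then have "r 0 < r 1" "power_word xs (2 * n (r 1) - n (r 0)) \<in> L"
    by (auto simp: \<L>(3) strict_mono_less)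
  then show ?thesis by blast
qed

section \<open>Word problems of poly-context-free groups\<close>

context group
begin

lemma word_value_closed: "set w \<subseteq> carrier G \<Longrightarrow> word_value G w \<in> carrier G"
  by (induction w) (auto simp: word_value_def)

lemma word_value_append:
  "set u \<subseteq> carrier G \<Longrightarrow> set v \<subseteq> carrier G \<Longrightarrow> word_value G (u @ v) = word_value G u \<otimes> word_value G v"
  using word_value_closed by (induction u) (auto simp: word_value_def m_assoc)

lemma word_value_repeat:
  "set u \<subseteq> carrier G \<Longrightarrow> word_value G (concat (replicate n u)) = word_value G u [^] n"
proof (induction n)
  case (Suc n)
  have "word_value G (u @ concat (replicate n u)) = word_value G u \<otimes> word_value G (concat (replicate n u))"
    using Suc.prems by (intro word_value_append) auto
  also have "\<dots> = word_value G u [^] Suc n"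
    using Suc by (simp only: nat_pow_Suc2[OF word_value_closed])
  finally show ?case by simp
qed (simp add: word_value_def)

lemma word_value_power_word:
  "\<Union>(set ` set xs) \<subseteq> carrier G \<Longrightarrow>
    word_value G (power_word xs n) = word_value G (map (\<lambda>x. word_value G x [^] n) xs)"
proof (induction xs)
  case (Cons x xs)
  have "word_value G (power_word (x # xs) n) = word_value G (concat (replicate n x)) \<otimes> word_value G (power_word xs n)"
    unfolding power_word_def using Cons.prems by (auto intro!: word_value_append)
  then show ?case using Cons by (simp add: word_value_repeat) (simp add: word_value_def)
qed (simp add: power_word_def)

lemma generated_by_words:
  assumes "S \<subseteq> carrier G" "m_inv G ` S = S" "g \<in> generate G S"
  shows "\<exists>w \<in> lists S. word_value G w = g"
  using assms(3)
proof induction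
  case one
  show ?case by (intro bexI[of _ "[]"]) (auto simp: word_value_def)
next
  case (incl h)
  then show ?case using assms(1) by (intro bexI[of _ "[h]"]) (auto simp: word_value_def)
next
  case (inv h)
  then have "inv h \<in> S" using assms(2) by blast
  then show ?case using assms(1) by (intro bexI[of _ "[inv h]"]) (auto simp: word_value_def)
next
  case (eng h1 h2)
  then obtain u v where "u \<in> lists S" "v \<in> lists S" "word_value G u = h1" "word_value G v = h2" by blast
  then show ?case using word_value_append[of u v] assms(1) by (intro bexI[of _ "u @ v"]) auto
qed

text \<open>The group elements are represented by words over the generating set; elements
  different from \<open>\<one>\<close> have nonempty words, so the automaton above applies.\<close>

theorem poly_context_free_group_extrapolation:
  fixes n :: "nat \<Rightarrow> nat"
  assumes "poly_context_free_group G" "set gs \<subseteq> carrier G - {\<one>}" "\<And>i. n i \<ge> 1"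
    "\<And>i. word_value G (map (\<lambda>g. g [^] n i) gs) = \<one>"
  shows "\<exists>i j. i < j \<and> word_value G (map (\<lambda>g. g [^] (2 * n j - n i)) gs) = \<one>"
proof -
  obtain S where S: "S \<subseteq> carrier G" "m_inv G ` S = S" "generate G S = carrier G"
      and pcf: "poly_context_free S (word_problem G S)"
    using assms(1) by (auto simp: poly_context_free_group_def finite_symmetric_generating_set_def)
  have "\<exists>w. \<forall>g\<in>carrier G. w g \<in> lists S \<and> word_value G (w g) = g"
    using generated_by_words[OF S(1,2)] S(3) by metis
  then obtain w where w: "\<And>g. g \<in> carrier G \<Longrightarrow> w g \<in> lists S" "\<And>g. g \<in> carrier G \<Longrightarrow> word_value G (w g) = g"
    by metis
  let ?xs = "map w gs"
  have "set (w g) \<subseteq> S" if "g \<in> set gs" for g using w(1)[of g] assms(2) that by (auto simp: lists_eq_set)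
  then have lists: "power_word ?xs m \<in> lists S" and car: "\<Union>(set ` set ?xs) \<subseteq> carrier G" for m
    using S(1) by (auto simp: power_word_def lists_eq_set) blast+
  have val: "power_word ?xs m \<in> word_problem G S \<longleftrightarrow> word_value G (map (\<lambda>g. g [^] m) gs) = \<one>" for m
  proof -
    have "map (\<lambda>x. word_value G x [^] m) ?xs = map (\<lambda>g. g [^] m) gs"
      using w(2) assms(2) by auto
    then have "word_value G (power_word ?xs m) = word_value G (map (\<lambda>g. g [^] m) gs)"
      using word_value_power_word[OF car, of m] by (simp only:)
    then show ?thesis using lists[of m] by (simp add: word_problem_def)
  qed
  have "[] \<notin> set ?xs"
  proof
    assume "[] \<in> set ?xs"
    then obtain g where "g \<in> set gs" "w g = []" by auto
    then show False using w(2)[of g] assms(2) by (auto simp: word_value_def)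
  qed
  from poly_context_free_power_extrapolation[OF pcf this, of n] show ?thesis
    using assms(3,4) by (simp only: val)
qed

end

section \<open>Squares and norms over finite fields\<close>

text \<open>Multiplication by a nonzero \<open>x\<close> permutes the nonzero elements, whose product is therefore unchanged.\<close>

lemma finite_field_power_card:
  fixes x :: "'a::{field,finite}"
  shows "x ^ CARD('a) = x"
proof (cases "x = 0")
  case False
  have "CARD('a) = Suc (card (UNIV - {0 :: 'a}))"
    using card.remove[of "UNIV :: 'a set" 0] by simp
  then have pow: "x ^ CARD('a) = x * x ^ card (UNIV - {0 :: 'a})" by (simp only: power_Suc)
  have "x ^ CARD('a) * \<Prod>(UNIV - {0}) = x * (\<Prod>y\<in>UNIV - {0}. x * y)"
    unfolding pow prod.distrib prod_constant by (simp only: mult_ac)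
  also have "(\<Prod>y\<in>UNIV - {0}. x * y) = \<Prod>(UNIV - {0})"
    by (rule prod.reindex_bij_witness[of _ "\<lambda>y. y / x" "\<lambda>y. x * y"]) (use False in auto)
  finally show ?thesis by simp
qed simp

lemma finite_field_power_card_minus_one:
  fixes x :: "'a::{field,finite}"
  assumes "x \<noteq> 0" "CARD('a) - 1 dvd m"
  shows "x ^ m = 1"
proof -
  have "x ^ (CARD('a) - 1) * x = x"
    using finite_field_power_card[of x] power_minus_mult[of "CARD('a)" x] by simp
  with assms show ?thesis by (auto simp: power_mult)
qed

lemma CHAR_of_prime_power_card:
  assumes "prime p" "CARD('a::{field,finite}) = p ^ k"
  shows "CHAR('a) = p"
proof -
  have "(\<Sum>x\<in>UNIV. x + 1) = (\<Sum>x\<in>(UNIV::'a set). x)"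
    by (rule sum.reindex_bij_witness[of _ "\<lambda>x. x - 1" "\<lambda>x. x + 1"]) auto
  then have "of_nat CARD('a) = (0::'a)" by (simp add: sum.distrib)
  then have "CHAR('a) dvd p ^ k" using assms(2) of_nat_eq_0_iff_char_dvd by metis
  moreover have "prime CHAR('a)" by (intro prime_CHAR_semidom finite_imp_CHAR_pos) simp
  ultimately show ?thesis using assms(1) by (metis prime_dvd_power primes_dvd_imp_eq)
qed

text \<open>Squaring is at most two-to-one.\<close>

lemma card_squares_ge:
  "CARD('a::{field,finite}) \<le> 2 * card (range (\<lambda>x::'a. x ^ 2))"
proof -
  have "card {x::'a. x ^ 2 = y} \<le> 2" for y
  proof (cases "\<exists>z. y = z ^ 2")
    case True
    then obtain z where "y = z ^ 2" by blast
    then have "{x. x ^ 2 = y} \<subseteq> {z, -z}" by (auto simp: power2_eq_iff)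
    then have "card {x. x ^ 2 = y} \<le> card {z, -z}" by (intro card_mono) auto
    also have "\<dots> \<le> 2" by (simp add: card_insert_if)
    finally show ?thesis .
  next
    case False
    then have "{x. x ^ 2 = y} = {}" by blast
    then show ?thesis by (simp only: card.empty)
  qed
  then have "(\<Sum>y\<in>range (\<lambda>x::'a. x ^ 2). card {x::'a. x ^ 2 = y}) \<le> (\<Sum>y\<in>range (\<lambda>x::'a. x ^ 2). 2)"
    by (intro sum_mono)
  moreover have "(UNIV::'a set) = (\<Union>y\<in>range (\<lambda>x::'a. x ^ 2). {x. x ^ 2 = y})" by auto
  then have "CARD('a) \<le> (\<Sum>y\<in>range (\<lambda>x::'a. x ^ 2). card {x::'a. x ^ 2 = y})"
    using card_UN_le[of "range (\<lambda>x::'a. x ^ 2)" "\<lambda>y. {x::'a. x ^ 2 = y}"] by simp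
  ultimately show ?thesis by simp
qed

text \<open>Otherwise the polynomial \<open>X\<^sup>m - 1\<close> with \<open>m = (q-1)/2\<close> would have \<open>c\<close> as a root in addition to
  at least \<open>m\<close> nonzero squares.\<close>

lemma nonsquare_half_power:
  fixes c :: "'a::{field,finite}"
  assumes "odd CARD('a)" "\<not> (\<exists>x. c = x ^ 2)"
  shows "c ^ ((CARD('a) - 1) div 2) = - 1"
proof (rule ccontr)
  let ?m = "(CARD('a) - 1) div 2"
  assume neq: "\<not> ?thesis"
  have m: "2 * ?m = CARD('a) - 1" using assms(1) by simp
  have one: "1 < CARD('a)" using card_mono[of UNIV "{0, 1 :: 'a}"] by simp
  then have mpos: "?m > 0" using m by linarith
  have c0: "c \<noteq> 0" using assms(2) by (metis zero_power2)
  have pow: "x ^ (2 * ?m) = 1" if "x \<noteq> 0" for x :: 'a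
    using finite_field_power_card_minus_one[OF that] m by simp
  have "(c ^ ?m) ^ 2 = 1" using pow[OF c0] by (simp add: power_mult mult.commute flip: power_mult)
  then have c1: "c ^ ?m = 1" using neq by (simp add: power2_eq_1_iff)
  let ?f = "monom 1 ?m + [:- 1:] :: 'a poly"
  have deg: "degree ?f = ?m"
    using mpos by (simp add: degree_add_eq_left degree_monom_eq)
  have "?f \<noteq> 0" using deg mpos by auto
  have "insert c (range (\<lambda>x. x ^ 2) - {0}) \<subseteq> {x. poly ?f x = 0}"
    using c1 pow by (auto simp: poly_monom simp flip: power_mult)
  then have "card (insert c (range (\<lambda>x::'a. x ^ 2) - {0})) \<le> card {x. poly ?f x = 0}"
    using poly_roots_finite[OF \<open>?f \<noteq> 0\<close>] by (intro card_mono)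
  also have "\<dots> \<le> ?m" using card_poly_roots_bound[OF \<open>?f \<noteq> 0\<close>] deg by simp
  finally have "card (range (\<lambda>x::'a. x ^ 2) - {0}) < ?m" using assms(2) by (subst (asm) card_insert_disjoint) auto
  moreover have "(0::'a) \<in> range (\<lambda>x. x ^ 2)" by (intro range_eqI[of _ _ 0]) simp
  then have "card (range (\<lambda>x::'a. x ^ 2)) = Suc (card (range (\<lambda>x::'a. x ^ 2) - {0}))"
    by (intro card.remove) auto
  ultimately show False using card_squares_ge[where 'a = 'a] m one by linarith
qed

text \<open>The sets of all \<open>x\<^sup>2\<close> and of all \<open>n + cy\<^sup>2\<close> both have more than \<open>q/2\<close> elements, so they meet. If this gives
  only a solution with \<open>x = 0\<close>, it is multiplied by the element \<open>(1 + c)/(1 - c) + 2/(1 - c) Z\<close> of norm one.\<close>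

lemma norm_represents:
  fixes c n :: "'a::{field,finite}"
  assumes "odd CARD('a)" "\<not> (\<exists>x. c = x ^ 2)" "n \<noteq> 0" and two: "(2::'a) \<noteq> 0"
  shows "\<exists>x y. x \<noteq> 0 \<and> x ^ 2 - c * y ^ 2 = n"
proof -
  have c0: "c \<noteq> 0" using assms(2) by (metis zero_power2)
  let ?S = "range (\<lambda>x::'a. x ^ 2)" and ?R = "range (\<lambda>y::'a. n + c * y ^ 2)"
  have "?R = (\<lambda>z. n + c * z) ` ?S" by (simp add: image_image)
  then have "card ?R = card ?S" using c0 by (simp add: card_image inj_on_def)
  then have "card ?S + card ?R > CARD('a)" using card_squares_ge[where 'a = 'a] assms(1) by presburger
  then have "?S \<inter> ?R \<noteq> {}"
    using card_Un_disjoint[of ?S ?R] card_mono[of UNIV "?S \<union> ?R"] by fastforce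
  then obtain x y where "x ^ 2 = n + c * y ^ 2" by auto
  then have xy: "x ^ 2 - c * y ^ 2 = n" by simp
  show ?thesis
  proof (cases "x = 0")
    case True
    let ?d = "1 - c" and ?r = "(1 + c) / (1 - c)" and ?s = "2 / (1 - c)"
    have d: "?d \<noteq> 0" using assms(2) by (metis eq_iff_diff_eq_0 one_power2)
    have unit: "?r ^ 2 - c * ?s ^ 2 = 1"
    proof -
      have "?r ^ 2 - c * ?s ^ 2 = ((1 + c) ^ 2 - c * 2 ^ 2) / ?d ^ 2"
        by (simp add: power_divide diff_divide_distrib)
      also have "(1 + c) ^ 2 - c * 2 ^ 2 = ?d ^ 2" by (simp add: power2_eq_square algebra_simps)
      finally show ?thesis using d by simp
    qed
    have "y \<noteq> 0" using xy True assms(3) by auto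
    then have "c * y * ?s \<noteq> 0" using c0 d two by simp
    moreover have "(c * y * s) ^ 2 - c * (y * r) ^ 2 = (- c * y ^ 2) * (r ^ 2 - c * s ^ 2)" for r s
      by (simp add: power2_eq_square algebra_simps)
    then have "(c * y * ?s) ^ 2 - c * (y * ?r) ^ 2 = n"
      using xy True unit by (metis diff_0 mult_1_right mult_minus_left power_zero_numeral)
    ultimately show ?thesis by blast
  qed (use xy in blast)
qed

section \<open>Powers in a quadratic extension\<close>

text \<open>The coefficients of \<open>(u + \<surd>e)\<^sup>n\<close> with respect to \<open>1\<close> and \<open>\<surd>e\<close>.\<close>

primrec quad_pow :: "'b::comm_ring_1 \<Rightarrow> 'b \<Rightarrow> nat \<Rightarrow> 'b \<times> 'b" where
  "quad_pow u e 0 = (1, 0)"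
| "quad_pow u e (Suc n) = (let (E, F) = quad_pow u e n in (E * u + e * F, E + F * u))"

lemma quad_pow_add:
  "fst (quad_pow u e (m + n)) =
     fst (quad_pow u e m) * fst (quad_pow u e n) + e * snd (quad_pow u e m) * snd (quad_pow u e n)"
  "snd (quad_pow u e (m + n)) =
     fst (quad_pow u e m) * snd (quad_pow u e n) + snd (quad_pow u e m) * fst (quad_pow u e n)"
  by (induction n) (simp_all add: split_beta Let_def algebra_simps)

lemma quad_pow_dvd:
  fixes u e :: "'b::idom"
  shows "[:- e, 0, 1:] dvd [:u, 1:] ^ n - [:fst (quad_pow u e n), snd (quad_pow u e n):]"
proof (induction n)
  case (Suc n)
  obtain E F where EF: "quad_pow u e n = (E, F)" by fastforce
  have "[:u, 1:] ^ Suc n - [:fst (quad_pow u e (Suc n)), snd (quad_pow u e (Suc n)):] =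
      [:u, 1:] * ([:u, 1:] ^ n - [:E, F:]) + [:F:] * [:- e, 0, 1:]"
    by (simp add: EF algebra_simps)
  moreover have "[:- e, 0, 1:] dvd [:u, 1:] * ([:u, 1:] ^ n - [:E, F:]) + [:F:] * [:- e, 0, 1:]"
    using Suc.IH by (intro dvd_add dvd_mult) (simp_all add: EF)
  ultimately show ?case by (simp only:)
qed (simp add: one_pCons)

text \<open>In the commutative ring of polynomials in \<open>X\<close>, the power \<open>(u + X)\<^sup>Q\<close> equals \<open>u\<^sup>Q + X\<^sup>Q\<close>. Reduce this
  modulo \<open>X\<^sup>2 - e\<close>; a multiple of this quadratic polynomial of degree at most one vanishes.\<close>

lemma quad_pow_frobenius:
  fixes u e :: "'b::idom"
  assumes "prime CHAR('b)" "Q = CHAR('b) ^ k" "odd Q"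
  shows "quad_pow u e Q = (u ^ Q, e ^ ((Q - 1) div 2))"
proof -
  let ?m = "[:- e, 0, 1:]" and ?l = "(Q - 1) div 2"
  have l: "Q = Suc (2 * ?l)" using assms(3) by (auto elim!: oddE)
  have "[:u, 1:] ^ Q = ([:u:] + [:0, 1:]) ^ Q" by simp
  also have "\<dots> = [:u:] ^ Q + [:0, 1:] ^ Q"
    using assms by (intro freshmans_dream') auto
  finally have frob: "[:u, 1:] ^ Q = [:u ^ Q:] + [:0, 1:] ^ Q" by (simp add: poly_const_pow)
  have "[:0, 1:] ^ 2 - [:e:] = ?m" by (simp add: power2_eq_square)
  then have "?m dvd ([:0, 1:] ^ 2) ^ ?l - [:e:] ^ ?l"
    by (simp only: power_diff_sumr2 dvd_triv_left)
  then have "?m dvd [:0, 1:] * (([:0, 1:] ^ 2) ^ ?l - [:e ^ ?l:])"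
    unfolding poly_const_pow by (rule dvd_mult)
  moreover have "[:0, 1:] * (([:0, 1:] ^ 2) ^ ?l - [:e ^ ?l:]) = [:0, 1:] ^ Q - [:0, e ^ ?l:]"
    by (subst (3) l) (simp add: algebra_simps power_mult)
  ultimately have "?m dvd [:0, 1:] ^ Q - [:0, e ^ ?l:]" by simp
  then have "?m dvd ([:u, 1:] ^ Q - [:fst (quad_pow u e Q), snd (quad_pow u e Q):]) - ([:0, 1:] ^ Q - [:0, e ^ ?l:])"
    using quad_pow_dvd[of e u Q] by (rule dvd_diff[rotated])
  also have "\<dots> = [:u ^ Q - fst (quad_pow u e Q), e ^ ?l - snd (quad_pow u e Q):]"
    by (simp add: frob)
  finally have dvd: "?m dvd [:u ^ Q - fst (quad_pow u e Q), e ^ ?l - snd (quad_pow u e Q):]" (is "_ dvd ?d") .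
  have "degree ?d < degree ?m" by simp
  then have "?d = 0" using dvd_imp_degree_le[OF dvd] by (meson not_le)
  then have "fst (quad_pow u e Q) = u ^ Q" "snd (quad_pow u e Q) = e ^ ?l" by simp_all
  then show ?thesis by (metis prod.collapse)
qed

text \<open>For \<open>U + V\<surd>e = (Y + H\<surd>e)\<^sup>2 / (X + h\<surd>e)\<close> the hypotheses are the two coefficients of
  \<open>(U + V\<surd>e) (X + h\<surd>e) = (Y + H\<surd>e)\<^sup>2\<close>, and the conclusions come from multiplying by \<open>X - h\<surd>e\<close>.\<close>

lemma quadratic_quotient:
  fixes X Y h H e U V :: "'b::idom"
  assumes "U * X + e * V * h = Y * Y + e * H * H" "U * h + V * X = Y * H + H * Y"
  shows "U * (X^2 - e * h^2) = X * (Y^2 + e * H^2) - 2 * e * h * Y * H"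
    and "V * (X^2 - e * h^2) = 2 * X * Y * H - h * (Y^2 + e * H^2)"
proof -
  have "U * (X^2 - e * h^2) = (U * X + e * V * h) * X - e * h * (U * h + V * X)"
    by (simp add: power2_eq_square algebra_simps)
  then show "U * (X^2 - e * h^2) = X * (Y^2 + e * H^2) - 2 * e * h * Y * H"
    unfolding assms by (simp add: power2_eq_square algebra_simps)
  have "V * (X^2 - e * h^2) = (U * h + V * X) * X - h * (U * X + e * V * h)"
    by (simp add: power2_eq_square algebra_simps)
  then show "V * (X^2 - e * h^2) = 2 * X * Y * H - h * (Y^2 + e * H^2)"
    unfolding assms by (simp add: power2_eq_square algebra_simps)
qed

text \<open>Here \<open>(U, V)\<close> and \<open>(U', V')\<close> are the quotients for \<open>e\<close> and for \<open>\<kappa>e\<close>, with the same \<open>X, Y, h, H\<close>. Once the denominators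
  are cleared, the difference \<open>UV' - U'V\<close> becomes, up to sign, the product on the left of the conclusion.\<close>

lemma cross_product_identity:
  fixes X Y h H e \<kappa> U V U' V' :: "'b::idom"
  assumes "U * X + e * V * h = Y * Y + e * H * H" "U * h + V * X = Y * H + H * Y"
    and "U' * X + \<kappa> * e * V' * h = Y * Y + \<kappa> * e * H * H" "U' * h + V' * X = Y * H + H * Y"
    and "U * V' = U' * V"
  shows "2 * (\<kappa> - 1) * e * H * Y * (X * H - h * Y) ^ 2 = 0"
proof -
  note 1 = quadratic_quotient(1)[OF assms(1,2)] and 2 = quadratic_quotient(2)[OF assms(1,2)]
    and 3 = quadratic_quotient(1)[OF assms(3,4)]
    and 4 = quadratic_quotient(2)[OF assms(3,4)]
  have "(X * (Y^2 + e * H^2) - 2 * e * h * Y * H) * (2 * X * Y * H - h * (Y^2 + \<kappa> * e * H^2)) =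
      (X * (Y^2 + \<kappa> * e * H^2) - 2 * (\<kappa> * e) * h * Y * H) * (2 * X * Y * H - h * (Y^2 + e * H^2))"
    unfolding 1[symmetric] 2[symmetric] 3[symmetric] 4[symmetric]
    using arg_cong[OF assms(5), of "\<lambda>z. z * ((X^2 - e * h^2) * (X^2 - \<kappa> * e * h^2))"]
    by (simp only: mult_ac)
  moreover have "2 * (\<kappa> - 1) * e * H * Y * (X * H - h * Y) ^ 2 =
      (X * (Y^2 + \<kappa> * e * H^2) - 2 * (\<kappa> * e) * h * Y * H) * (2 * X * Y * H - h * (Y^2 + e * H^2)) -
      (X * (Y^2 + e * H^2) - 2 * e * h * Y * H) * (2 * X * Y * H - h * (Y^2 + \<kappa> * e * H^2))"
    by (simp add: power2_eq_square algebra_simps)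
  ultimately show ?thesis by simp
qed

text \<open>An opaque constant, so that ring normalisation treats coefficients as ordinary factors and does not
  turn them into scalar multiplications.\<close>

definition const_poly :: "'a::comm_ring_1 \<Rightarrow> 'a poly" where
  "const_poly a = [:a:]"

lemma const_poly_hom:
  "const_poly (a + b) = const_poly a + const_poly b"
  "const_poly (a - b) = const_poly a - const_poly b"
  "const_poly (a * b) = const_poly a * const_poly b"
  "const_poly (- a) = - const_poly a"
  "const_poly (a ^ n) = const_poly a ^ n"
  "const_poly 0 = 0"
  "const_poly 1 = 1"
  by (simp_all add: const_poly_def poly_const_pow one_pCons)

lemma const_poly_eq_0_iff [simp]: "const_poly a = 0 \<longleftrightarrow> a = 0"
  by (simp add: const_poly_def)

text \<open>The value \<open>t(t-1)\<close> of \<open>F\<^sup>2\<close>.\<close>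

definition T_poly :: "'a::comm_ring_1 poly" where
  "T_poly = [:0, 1:] * ([:0, 1:] - 1)"

lemma T_poly_neq_0 [simp]: "T_poly \<noteq> (0 :: 'a::idom poly)"
  by (simp add: T_poly_def one_pCons)

lemma geometric_dvd: "(x::nat) - 1 dvd x ^ i - 1"
proof (induction i)
  case (Suc i)
  show ?case
  proof (cases "x = 0")
    case False
    then have "x ^ Suc i - 1 = x * (x ^ i - 1) + (x - 1)"
      by (simp add: algebra_simps)
    then show ?thesis using Suc by (metis dvd_add dvd_mult dvd_refl)
  qed simp
qed simp

text \<open>The even exponent gives the second claim: \<open>q\<^sup>2 - 1 = 2(q-1) \<cdot> (q+1)/2\<close> divides \<open>q\<^bsup>2i\<^esup> - 1\<close>.\<close>

lemma half_exponent:
  fixes q :: nat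
  assumes "odd q"
  shows "odd (q ^ (2 * i))" "q - 1 dvd (q ^ (2 * i) - 1) div 2"
proof -
  show "odd (q ^ (2 * i))" using assms by simp
  obtain r where r: "q = 2 * r + 1" using assms by (auto elim: oddE)
  have "q ^ 2 - 1 = 2 * (q - 1) * (r + 1)" by (simp add: r power2_eq_square algebra_simps)
  then have "2 * (q - 1) dvd q ^ 2 - 1" by simp
  also have "q ^ 2 - 1 dvd (q ^ 2) ^ i - 1" by (rule geometric_dvd)
  finally obtain m where "q ^ (2 * i) - 1 = 2 * (q - 1) * m" by (auto simp: power_mult)
  then show "q - 1 dvd (q ^ (2 * i) - 1) div 2" by (simp add: mult.assoc)
qed

text \<open>The scalar \<open>a\<close> disappears because \<open>q - 1\<close> divides \<open>(Q-1)/2\<close>. For this reason the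
  powers of both kinds of generators of \<open>\<Gamma>\<^sub>\<tau>\<close> with exponent \<open>q\<^bsup>2i\<^esup>\<close> have the same coefficients.\<close>

lemma frobenius_quad_pow:
  fixes u T :: "'a::{field,finite} poly"
  assumes "prime p" "odd p" "CARD('a) = p ^ k" "Q = CARD('a) ^ (2 * i)" "a \<noteq> 0"
  shows "quad_pow u (const_poly a * T) Q = (u ^ Q, T ^ ((Q - 1) div 2))"
proof -
  have "odd CARD('a)" using assms by simp
  note half = half_exponent[OF this, of i]
  have char: "CHAR('a poly) = p" using CHAR_of_prime_power_card[OF assms(1,3)] by simp
  have "Q = p ^ (k * (2 * i))" by (simp add: assms(3,4) power_mult)
  then have "quad_pow u (const_poly a * T) Q = (u ^ Q, (const_poly a * T) ^ ((Q - 1) div 2))"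
    using quad_pow_frobenius[of Q "k * (2 * i)" u "const_poly a * T"] assms(1) half(1) by (simp only: char assms(4)) simp
  also have "const_poly a ^ ((Q - 1) div 2) = 1"
    using finite_field_power_card_minus_one[OF assms(5) half(2)] by (simp add: assms(4) const_poly_hom flip: const_poly_hom(5))
  then have "(const_poly a * T) ^ ((Q - 1) div 2) = T ^ ((Q - 1) div 2)"
    by (simp only: power_mult_distrib mult_1)
  finally show ?thesis .
qed

text \<open>With \<open>P = q\<^bsup>2i\<^esup>\<close> and \<open>Q = q\<^bsup>2j\<^esup>\<close>, the coefficients for the exponent \<open>m = 2Q - P\<close> are a quotient as in
  \<open>quadratic_quotient\<close>. The polynomials whose vanishing has to be excluded contain a power of \<open>h = T\<^bsup>(P-1)/2\<^esup>\<close>, and the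
  cofactors are evaluated at \<open>t = 1\<close>, where \<open>T\<close> vanishes and \<open>u\<close> does not.\<close>

lemma extrapolated_exponent_separates:
  fixes c \<kappa> :: "'a::{field,finite}"
  assumes "prime p" "odd p" "CARD('a) = p ^ k" "i < j" "c \<noteq> 0" "\<kappa> \<noteq> 0" "\<kappa> \<noteq> 1"
  defines "u \<equiv> [:0, c:]" and "T \<equiv> T_poly" and "m \<equiv> 2 * CARD('a) ^ (2 * j) - CARD('a) ^ (2 * i)"
  defines "e \<equiv> const_poly (c ^ 2) * T" and "e' \<equiv> const_poly (\<kappa> * c ^ 2) * T"
  shows "snd (quad_pow u e m) \<noteq> 0" "snd (quad_pow u e' m) \<noteq> 0"
    "fst (quad_pow u e m) * snd (quad_pow u e' m) \<noteq> fst (quad_pow u e' m) * snd (quad_pow u e m)"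
proof -
  define P where "P = CARD('a) ^ (2 * i)"
  define Q where "Q = CARD('a) ^ (2 * j)"
  define X where "X = u ^ P"
  define Y where "Y = u ^ Q"
  define h where "h = T ^ ((P - 1) div 2)"
  define r where "r = (Q - P) div 2"
  have oddq: "odd CARD('a)" using assms(2,3) by simp
  have one: "1 < CARD('a)" using card_mono[of UNIV "{0, 1 :: 'a}"] by simp
  have PQ: "P < Q" using one assms(4) by (simp add: P_def Q_def)
  have oddP: "odd P" "odd Q" using half_exponent(1)[OF oddq] by (simp_all add: P_def Q_def)
  have r: "r > 0" "(Q - 1) div 2 = (P - 1) div 2 + r"
    using oddP PQ by (auto simp: r_def elim!: oddE)
  have frob: "quad_pow u (const_poly a * T) P = (X, h)" "quad_pow u (const_poly a * T) Q = (Y, h * T ^ r)" if "a \<noteq> 0" for a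
    using frobenius_quad_pow[OF assms(1-3) P_def that, where u = u and T = T]
      frobenius_quad_pow[OF assms(1-3) Q_def that, where u = u and T = T]
    by (simp_all only: X_def Y_def h_def r(2) power_add)
  have mPQ: "m + P = Q + Q" using PQ by (simp add: m_def P_def Q_def)
  have eqs: "fst (quad_pow u (const_poly a * T) m) * X + (const_poly a * T) * snd (quad_pow u (const_poly a * T) m) * h =
        Y * Y + (const_poly a * T) * (h * T ^ r) * (h * T ^ r)"
      "fst (quad_pow u (const_poly a * T) m) * h + snd (quad_pow u (const_poly a * T) m) * X = Y * (h * T ^ r) + (h * T ^ r) * Y"
    if "a \<noteq> 0" for a
    using quad_pow_add[of u "const_poly a * T" m P] quad_pow_add[of u "const_poly a * T" Q Q] frob[OF that]
    by (simp_all only: mPQ fst_conv snd_conv)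
  have T1: "poly T 1 = 0" and T0: "T \<noteq> 0" by (simp_all add: T_def T_poly_def one_pCons)
  have u1: "poly u 1 = c" by (simp add: u_def)
  have h0: "h \<noteq> 0" using T0 by (simp add: h_def)
  have Y0: "Y \<noteq> 0" using assms(5) by (simp add: Y_def u_def)
  have snd_nz: "snd (quad_pow u (const_poly a * T) m) \<noteq> 0" if a: "a \<noteq> 0" for a
  proof
    let ?e = "const_poly a * T"
    let ?G = "2 * X * Y * T ^ r - (Y ^ 2 + ?e * (h * T ^ r) ^ 2)"
    assume "snd (quad_pow u ?e m) = 0"
    then have "h * ?G = 0"
      using quadratic_quotient(2)[OF eqs[OF a]] by (simp add: algebra_simps)
    then have "poly ?G 1 = 0" using h0 by simp
    then show False using T1 u1 r(1) assms(5) by (simp add: Y_def poly_power zero_power)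
  qed
  show "snd (quad_pow u e m) \<noteq> 0" "snd (quad_pow u e' m) \<noteq> 0"
    unfolding e_def e'_def using assms(5,6) by (intro snd_nz; simp)+
  have \<kappa>e: "e' = const_poly \<kappa> * e" by (simp add: e'_def e_def const_poly_hom)
  have c2: "c ^ 2 \<noteq> 0" "\<kappa> * c ^ 2 \<noteq> 0" using assms(5,6) by simp_all
  show "fst (quad_pow u e m) * snd (quad_pow u e' m) \<noteq> fst (quad_pow u e' m) * snd (quad_pow u e m)"
  proof
    assume eq: "fst (quad_pow u e m) * snd (quad_pow u e' m) = fst (quad_pow u e' m) * snd (quad_pow u e m)"
    have "2 * (const_poly \<kappa> - 1) * e * (h * T ^ r) * Y * (X * (h * T ^ r) - h * Y) ^ 2 = 0"
      by (rule cross_product_identity[OF eqs(1)[OF c2(1), folded e_def] eqs(2)[OF c2(1), folded e_def]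
        eqs(1)[OF c2(2), folded e'_def, unfolded \<kappa>e] eqs(2)[OF c2(2), folded e'_def, unfolded \<kappa>e]
        eq[unfolded \<kappa>e]])
    moreover have "(2 :: 'a poly) \<noteq> 0"
    proof
      assume "(2 :: 'a poly) = 0"
      then have "CHAR('a poly) dvd 2" using of_nat_eq_0_iff_char_dvd[of 2, where 'a = "'a poly"] by simp
      then have "p dvd 2" using CHAR_of_prime_power_card[OF assms(1,3)] by simp
      then show False using assms(1,2) by (metis primes_dvd_imp_eq two_is_prime_nat dvd_refl)
    qed
    moreover have "const_poly \<kappa> - 1 \<noteq> 0" using assms(7) by (simp add: const_poly_def one_pCons)
    moreover have "e \<noteq> 0" using assms(5) T0 by (simp add: e_def)
    ultimately have "h * (X * T ^ r - Y) = 0" using T0 h0 Y0 by (simp add: algebra_simps)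
    then have "poly (X * T ^ r - Y) 1 = 0" using h0 by simp
    then show False using T1 u1 r(1) assms(5) by (simp add: Y_def poly_power zero_power)
  qed
qed

section \<open>Elements \<open>u + v\<xi>FZ\<close> of the quaternion algebra\<close>

text \<open>The element \<open>u + v\<xi>FZ\<close> for \<open>\<xi> = x + yZ\<close>, using \<open>\<xi>FZ = -cyF - xZF\<close>.\<close>

definition quad_elem :: "'a::{field,finite} \<Rightarrow> 'a \<Rightarrow> 'a \<Rightarrow> 'a poly \<Rightarrow> 'a poly \<Rightarrow> 'a poly fract quat" where
  "quad_elem c x y u v = Quat (to_fract u) 0 (to_fract (- const_poly (c * y) * v)) (to_fract (- const_poly x * v))"

lemma D_alg_mult: "a \<otimes>\<^bsub>D_alg c\<^esub> b = quat_mult (to_fract (const_poly c)) (to_fract T_poly) a b"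
  by (simp only: D_alg_def quat_ring_simps const_poly_def T_poly_def ratfun_const_def ratfun_t_def to_fract_mult to_fract_diff to_fract_1)

lemma quad_elem_mult:
  "quad_elem c x y u v \<otimes>\<^bsub>D_alg c\<^esub> quad_elem c x' y' u' v' =
     Quat (to_fract (u * u' - const_poly (c * (x * x' - c * y * y')) * T_poly * v * v'))
          (to_fract (const_poly (c * (x * y' - y * x')) * T_poly * v * v'))
          (to_fract (- const_poly c * (const_poly y' * u * v' + const_poly y * u' * v)))
          (to_fract (- (const_poly x' * u * v' + const_poly x * u' * v)))"
proof -
  have hom: "to_fract a * to_fract b = to_fract (a * b)" "to_fract a + to_fract b = to_fract (a + b)"
    "to_fract a - to_fract b = to_fract (a - b)" "- to_fract a = to_fract (- a)" "(0 :: 'a poly fract) = to_fract 0"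
    for a b :: "'a poly" by simp_all
  show ?thesis
    unfolding D_alg_mult quad_elem_def quat_mult_def quat.case prod.case hom
    by (simp only: quat.inject to_fract_eq_iff) (simp add: const_poly_hom algebra_simps)
qed

lemma gen_elem_eq:
  "gen_elem c (Quat (ratfun_const x) (ratfun_const y) 0 0) = quad_elem c x y [:0, c:] 1"
  by (simp add: gen_elem_def D_alg_def quat_defs quad_elem_def const_poly_def ratfun_const_def ratfun_t_def
    flip: to_fract_mult to_fract_uminus)

lemma quad_elem_pow:
  fixes c x y :: "'a::{field,finite}"
  defines "e \<equiv> const_poly (- c * (x ^ 2 - c * y ^ 2)) * T_poly"
  shows "quad_elem c x y u 1 [^]\<^bsub>D_alg c\<^esub> (n::nat) =
    quad_elem c x y (fst (quad_pow u e n)) (snd (quad_pow u e n))"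
proof (induction n)
  case 0
  show ?case by (simp add: quad_elem_def D_alg_def quat_defs nat_pow_def)
next
  case (Suc n)
  interpret ring "D_alg c" unfolding D_alg_def by (rule ring_quat_ring)
  obtain E F where EF: "quad_pow u e n = (E, F)" by fastforce
  have "quad_elem c x y u 1 [^]\<^bsub>D_alg c\<^esub> Suc n = quad_elem c x y E F \<otimes>\<^bsub>D_alg c\<^esub> quad_elem c x y u 1"
    using Suc by (simp add: EF)
  also have "\<dots> = quad_elem c x y (E * u + e * F) (E + F * u)"
    unfolding quad_elem_mult unfolding quad_elem_def
    by (simp only: quat.inject to_fract_eq_iff) (simp add: e_def const_poly_hom power2_eq_square algebra_simps)
  finally show ?case by (simp add: EF)
qed

text \<open>The hypotheses on the parameters \<open>\<xi> = Z\<close>, \<open>\<eta> = x + yZ\<close>, \<open>\<xi>' = x1 + y1 Z\<close>, \<open>\<eta>' = x2 + y2 Z\<close> say that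
  \<open>\<xi>' + \<eta>' = \<xi> + \<eta>\<close> and that \<open>\<eta>'\<close> times the conjugate of \<open>\<xi>'\<close> equals \<open>\<xi>\<close> times the conjugate of \<open>\<eta>\<close>. Then both
  products have the same \<open>1\<close>- and \<open>Z\<close>-coordinates. Since \<open>x \<noteq> 0\<close>, the \<open>Z\<close>-coordinate is not zero, so that
  \<open>k = 1\<close>; the other two coordinates differ by multiples of \<open>uv' - u'v\<close>, not both zero because \<open>\<xi>' \<noteq> \<xi>\<close>.\<close>

lemma twisted_commutation:
  fixes c x y :: "'a::{field,finite}"
  assumes "c \<noteq> 0" "x \<noteq> 0" "(2::'a) \<noteq> 0" "v \<noteq> 0" "v' \<noteq> 0"
    and "x1 + x2 = x" "y1 + y2 = y + 1"
    and "x2 * x1 - c * y2 * y1 = - c * y" "x2 * y1 - y2 * x1 = - x"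
  shows "(\<exists>k. k \<noteq> 0 \<and> quad_elem c 0 1 u v \<otimes>\<^bsub>D_alg c\<^esub> quad_elem c x y u' v' =
      quat_scalar k \<otimes>\<^bsub>D_alg c\<^esub> (quad_elem c x2 y2 u' v' \<otimes>\<^bsub>D_alg c\<^esub> quad_elem c x1 y1 u v)) \<longleftrightarrow> u * v' = u' * v"
    (is "(\<exists>k. k \<noteq> 0 \<and> ?L = _ \<otimes>\<^bsub>_\<^esub> ?R) \<longleftrightarrow> _")
proof -
  let ?w = "to_fract (u * u' + const_poly (c * c * y) * T_poly * v * v')" and ?z = "to_fract (const_poly (- c * x) * T_poly * v * v')"
  have L: "?L = Quat ?w ?z (to_fract (- const_poly c * (const_poly y * u * v' + u' * v))) (to_fract (- const_poly x * u * v'))"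
    unfolding quad_elem_mult by (simp only: quat.inject to_fract_eq_iff) (simp add: const_poly_hom algebra_simps)
  have R: "?R = Quat ?w ?z (to_fract (- const_poly c * (const_poly y2 * u * v' + const_poly y1 * u' * v)))
      (to_fract (- (const_poly x2 * u * v' + const_poly x1 * u' * v)))"
    unfolding quad_elem_mult assms(8,9)
    by (simp only: quat.inject to_fract_eq_iff) (simp add: const_poly_hom algebra_simps)
  have scal: "quat_scalar k \<otimes>\<^bsub>D_alg c\<^esub> Quat a b d e = Quat (k * a) (k * b) (k * d) (k * e)" for k a b d e
    by (simp add: D_alg_def quat_defs)
  have "?z \<noteq> 0" using assms by simp
  show ?thesis
  proof
    assume eq: "u * v' = u' * v"
    have "?L = ?R" unfolding L R
    proof (simp only: quat.inject to_fract_eq_iff simp_thms, intro conjI)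
      have "const_poly y2 + const_poly y1 = const_poly y + 1" "const_poly x2 + const_poly x1 = const_poly x"
        using assms(6,7) by (simp_all add: ac_simps flip: const_poly_hom)
      then show "- const_poly c * (const_poly y * u * v' + u' * v) = - const_poly c * (const_poly y2 * u * v' + const_poly y1 * u' * v)"
          "- const_poly x * u * v' = - (const_poly x2 * u * v' + const_poly x1 * u' * v)"
        unfolding mult.assoc eq by (simp_all only: flip: distrib_right) (simp_all add: algebra_simps)
    qed
    then show "\<exists>k. k \<noteq> 0 \<and> ?L = quat_scalar k \<otimes>\<^bsub>D_alg c\<^esub> ?R" using scal[of 1] by (intro exI[of _ 1]) (simp add: R)
  next
    assume "\<exists>k. k \<noteq> 0 \<and> ?L = quat_scalar k \<otimes>\<^bsub>D_alg c\<^esub> ?R"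
    then obtain k where k: "?L = quat_scalar k \<otimes>\<^bsub>D_alg c\<^esub> ?R" by blast
    then have "?z = k * ?z" unfolding L R scal by (simp only: quat.inject)
    then have "k = 1" using \<open>?z \<noteq> 0\<close> by simp
    with k have "const_poly c * (const_poly y * u * v' + u' * v) = const_poly c * (const_poly y2 * u * v' + const_poly y1 * u' * v)"
        and 2: "const_poly x * u * v' = const_poly x2 * u * v' + const_poly x1 * u' * v"
      unfolding L R scal by (simp_all only: quat.inject mult_1 to_fract_eq_iff neg_equal_iff_equal mult_minus_left)
    then have 1: "const_poly y * u * v' + u' * v = const_poly y2 * u * v' + const_poly y1 * u' * v" using assms(1) by simp
    have x: "x = x1 + x2" and y: "y = y1 + y2 - 1" using assms(6,7) by (simp_all add: algebra_simps)
    have "const_poly x1 * (u * v' - u' * v) = 0" using 2 unfolding x by (simp add: const_poly_hom algebra_simps)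
    moreover have "const_poly (y1 - 1) * (u * v' - u' * v) = 0"
      using 1 unfolding y by (simp add: const_poly_hom algebra_simps)
    moreover have "x1 \<noteq> 0 \<or> y1 \<noteq> 1"
      using assms(2,3,6,9) by (metis add_0 mult.right_neutral mult_zero_right diff_zero eq_neg_iff_add_eq_0 mult_2 mult_eq_0_iff)
    ultimately show "u * v' = u' * v" by auto
  qed
qed

section \<open>The group \<open>\<Gamma>\<^sub>\<tau>\<close>\<close>

lemma ratfun_const_hom:
  "ratfun_const (a + b) = ratfun_const a + ratfun_const b"
  "ratfun_const (a - b) = ratfun_const a - ratfun_const b"
  "ratfun_const (a * b) = ratfun_const a * ratfun_const b"
  "ratfun_const (- a) = - ratfun_const a"
  "ratfun_const 0 = 0"
  "ratfun_const 1 = 1"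
  by (simp_all add: ratfun_const_def one_pCons flip: to_fract_add to_fract_diff to_fract_mult to_fract_uminus to_fract_1)

text \<open>The element \<open>x + yZ\<close> behaves like \<open>x + \<surd>(cy\<^sup>2)\<close>.\<close>

lemma Fq_Z_pow:
  "Quat (ratfun_const x) (ratfun_const y) 0 0 [^]\<^bsub>D_alg c\<^esub> (n::nat) =
    Quat (ratfun_const (fst (quad_pow x (c * y ^ 2) n))) (ratfun_const (y * snd (quad_pow x (c * y ^ 2) n))) 0 0"
proof (induction n)
  case 0
  show ?case by (simp add: D_alg_def quat_defs nat_pow_def ratfun_const_hom)
next
  case (Suc n)
  obtain E F where EF: "quad_pow x (c * y ^ 2) n = (E, F)" by fastforce
  have IH: "Quat (ratfun_const x) (ratfun_const y) 0 0 [^]\<^bsub>D_alg c\<^esub> n = Quat (ratfun_const E) (ratfun_const (y * F)) 0 0"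
    using Suc by (simp only: EF fst_conv snd_conv)
  show ?case
    unfolding D_alg_def quat_pow_Suc IH[unfolded D_alg_def] quad_pow.simps Let_def EF prod.case fst_conv snd_conv
    by (simp add: quat_defs power2_eq_square algebra_simps ratfun_const_hom)
qed

text \<open>By the Frobenius formula and Euler's criterion, the \<open>q\<close>-th power of \<open>x + yZ\<close> is \<open>x - yZ\<close>.\<close>

lemma norm_fibreI:
  fixes c x y n :: "'a::{field,finite}"
  assumes "prime p" "odd p" "CARD('a) = p ^ k" "\<not> (\<exists>z. c = z ^ 2)" "x ^ 2 - c * y ^ 2 = n" "n \<noteq> 0"
  shows "Quat (ratfun_const x) (ratfun_const y) 0 0 \<in> norm_fibre c n"
proof -
  let ?q = "CARD('a)"
  have odd: "odd ?q" using assms(2,3) by simp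
  have "quad_pow x (c * y ^ 2) ?q = (x ^ ?q, (c * y ^ 2) ^ ((?q - 1) div 2))"
    using quad_pow_frobenius[of ?q k x "c * y ^ 2"] assms(1) odd
    by (simp add: CHAR_of_prime_power_card[OF assms(1,3)] flip: assms(3))
  moreover have "x ^ ?q = x" by (rule finite_field_power_card)
  moreover have "y * (c * y ^ 2) ^ ((?q - 1) div 2) = - y"
  proof -
    have "y * (y ^ 2) ^ ((?q - 1) div 2) = y ^ Suc (2 * ((?q - 1) div 2))" by (simp add: power_mult)
    also have "Suc (2 * ((?q - 1) div 2)) = ?q" using odd by (auto elim!: oddE)
    also have "y ^ ?q = y" by (rule finite_field_power_card)
    finally show ?thesis
      unfolding power_mult_distrib nonsquare_half_power[OF odd assms(4)] by simp
  qed
  ultimately have conj: "Fq_Z_conj c (Quat (ratfun_const x) (ratfun_const y) 0 0) =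
      Quat (ratfun_const x) (ratfun_const (- y)) 0 0"
    unfolding Fq_Z_conj_def Fq_Z_pow by simp
  have "Fq_Z_norm c (Quat (ratfun_const x) (ratfun_const y) 0 0) = quat_scalar (ratfun_const (x ^ 2 - c * y ^ 2))"
    unfolding Fq_Z_norm_def conj by (simp add: D_alg_def quat_defs ratfun_const_hom power2_eq_square algebra_simps)
  moreover have "Quat (ratfun_const x) (ratfun_const y) 0 0 \<noteq> \<zero>\<^bsub>D_alg c\<^esub>"
    using assms(5,6) by (auto simp: D_alg_def quat_defs ratfun_const_def)
  ultimately show ?thesis
    using assms(5) by (auto simp: norm_fibre_def Fq_Z_eq)
qed

lemma K_units_mult: "K_units #>\<^bsub>units_of (D_alg c)\<^esub> b = {quat_scalar k \<otimes>\<^bsub>D_alg c\<^esub> b | k. k \<noteq> 0}"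
  by (auto simp: r_coset_def K_units_def units_of_mult)

lemma D_class_eq_iff:
  assumes "a \<in> Units (D_alg c)" "b \<in> Units (D_alg c)"
  shows "D_class c a = D_class c b \<longleftrightarrow> (\<exists>k. k \<noteq> 0 \<and> a = quat_scalar k \<otimes>\<^bsub>D_alg c\<^esub> b)"
proof -
  interpret R: ring "D_alg c" unfolding D_alg_def by (rule ring_quat_ring)
  interpret U: group "units_of (D_alg c)" by (rule R.units_group)
  interpret N: normal K_units "units_of (D_alg c)" by (rule K_units_normal)
  have "D_class c a = D_class c b \<longleftrightarrow> a \<in> D_class c b"
    using U.rcos_self[OF _ N.subgroup_axioms, of a] U.repr_independence[OF _ _ N.subgroup_axioms, of a b] assms
    by (auto simp: D_class_def units_of_carrier)
  then show ?thesis by (auto simp: D_class_def K_units_mult)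
qed

lemma (in monoid) Units_nat_pow_closed: "x \<in> Units G \<Longrightarrow> x [^] (n::nat) \<in> Units G"
  by (induction n) simp_all

lemma D_class_hom:
  assumes "a \<in> Units (D_alg c)" "b \<in> Units (D_alg c)"
  shows "D_class c a \<in> carrier (D_units_mod_K_units c)"
    "D_class c a \<otimes>\<^bsub>D_units_mod_K_units c\<^esub> D_class c b = D_class c (a \<otimes>\<^bsub>D_alg c\<^esub> b)"
    "D_class c a [^]\<^bsub>D_units_mod_K_units c\<^esub> (n::nat) = D_class c (a [^]\<^bsub>D_alg c\<^esub> n)"
    "D_class c (\<one>\<^bsub>D_alg c\<^esub>) = \<one>\<^bsub>D_units_mod_K_units c\<^esub>"
proof -
  interpret R: ring "D_alg c" unfolding D_alg_def by (rule ring_quat_ring)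
  interpret U: group "units_of (D_alg c)" by (rule R.units_group)
  interpret N: normal K_units "units_of (D_alg c)" by (rule K_units_normal)
  interpret G: group "D_units_mod_K_units c"
    unfolding D_units_mod_K_units_def by (rule N.factorgroup_is_group)
  show "D_class c a \<in> carrier (D_units_mod_K_units c)"
    unfolding D_class_def D_units_mod_K_units_def FactGroup_def
    using assms by (auto simp: units_of_carrier intro: U.rcosetsI[OF N.subset])
  have mult: "D_class c a \<otimes>\<^bsub>D_units_mod_K_units c\<^esub> D_class c b = D_class c (a \<otimes>\<^bsub>D_alg c\<^esub> b)"
    if "a \<in> Units (D_alg c)" "b \<in> Units (D_alg c)" for a b
    unfolding D_class_def D_units_mod_K_units_def FactGroup_def
    using N.rcos_sum[of a b] that by (simp add: units_of_carrier units_of_mult)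
  then show "D_class c a \<otimes>\<^bsub>D_units_mod_K_units c\<^esub> D_class c b = D_class c (a \<otimes>\<^bsub>D_alg c\<^esub> b)"
    using assms by blast
  show one: "D_class c (\<one>\<^bsub>D_alg c\<^esub>) = \<one>\<^bsub>D_units_mod_K_units c\<^esub>"
    unfolding D_class_def D_units_mod_K_units_def FactGroup_def
    using U.coset_mult_one[OF N.subset] by (simp add: units_of_one)
  show "D_class c a [^]\<^bsub>D_units_mod_K_units c\<^esub> n = D_class c (a [^]\<^bsub>D_alg c\<^esub> n)"
    using assms(1) by (induction n) (simp_all add: one mult R.Units_nat_pow_closed)
qed

text \<open>With \<open>w = y + 1\<close> and \<open>s = x + wZ\<close>, the solution is \<open>\<xi>' = -Z s\<^sup>2 / N(s)\<close> and \<open>\<eta>' = s - \<xi>'\<close>. Since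
  \<open>N(s)\<close> is \<open>s\<close> times its conjugate, \<open>\<xi>'\<close> is the conjugate of \<open>Z\<close> times the quotient of \<open>s\<close> by its conjugate. The
  common denominator of the coordinates is \<open>d = N(s)\<close>.\<close>

lemma dual_square:
  fixes c x y :: "'a::field"
  assumes "x \<noteq> 0" "\<not> (\<exists>z. c = z ^ 2)"
  obtains x1 y1 x2 y2 where "x1 + x2 = x" "y1 + y2 = y + 1" "x1 ^ 2 - c * y1 ^ 2 = - c"
    "x2 ^ 2 - c * y2 ^ 2 = x ^ 2 - c * y ^ 2"
    "x2 * x1 - c * y2 * y1 = - c * y" "x2 * y1 - y2 * x1 = - x"
proof -
  define w where "w = y + 1"
  define d where "d = x ^ 2 - c * w ^ 2"
  have d: "d \<noteq> 0"
  proof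
    assume "d = 0"
    then have "c * w ^ 2 = x ^ 2" by (simp add: d_def)
    then have "w \<noteq> 0" using assms(1) by auto
    then have "c = (x / w) ^ 2" using \<open>c * w ^ 2 = x ^ 2\<close> by (simp add: power_divide eq_divide_eq)
    then show False using assms(2) by blast
  qed
  define x1 where "x1 = - 2 * c * x * w / d"
  define y1 where "y1 = - (x ^ 2 + c * w ^ 2) / d"
  have dx1: "d * x1 = - 2 * c * x * w" and dy1: "d * y1 = - (x ^ 2 + c * w ^ 2)"
    using d by (simp_all add: x1_def y1_def)
  have "d * (x * x1 - c * w * y1) = x * (d * x1) - c * w * (d * y1)" by (simp add: algebra_simps)
  also have "\<dots> = d * (- c * w)"
    unfolding dx1 dy1 by (simp add: d_def power2_eq_square algebra_simps)
  finally have re: "x * x1 - c * w * y1 = - c * w" unfolding mult_cancel_left using d by blast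
  have "d * (x * y1 - w * x1) = x * (d * y1) - w * (d * x1)" by (simp add: algebra_simps)
  also have "\<dots> = d * (- x)"
    unfolding dx1 dy1 by (simp add: d_def power2_eq_square algebra_simps)
  finally have im: "x * y1 - w * x1 = - x" unfolding mult_cancel_left using d by blast
  have "d ^ 2 * (x1 ^ 2 - c * y1 ^ 2) = (d * x1) ^ 2 - c * (d * y1) ^ 2"
    by (simp add: power2_eq_square algebra_simps)
  also have "\<dots> = d ^ 2 * (- c)"
    unfolding dx1 dy1 by (simp add: d_def power2_eq_square algebra_simps)
  finally have norm: "x1 ^ 2 - c * y1 ^ 2 = - c" unfolding mult_cancel_left using d by simp
  show thesis
  proof (rule that[of x1 "x - x1" y1 "w - y1"])
    have "(x - x1) ^ 2 - c * (w - y1) ^ 2 = d - 2 * (x * x1 - c * w * y1) + (x1 ^ 2 - c * y1 ^ 2)"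
      by (simp add: d_def power2_eq_square algebra_simps)
    also have "\<dots> = x ^ 2 - c * y ^ 2"
      unfolding re norm by (simp add: d_def w_def power2_eq_square algebra_simps)
    finally show "(x - x1) ^ 2 - c * (w - y1) ^ 2 = x ^ 2 - c * y ^ 2" .
    have "(x - x1) * x1 - c * (w - y1) * y1 = (x * x1 - c * w * y1) - (x1 ^ 2 - c * y1 ^ 2)"
      by (simp add: power2_eq_square algebra_simps)
    also have "\<dots> = - c * y" unfolding re norm by (simp add: w_def algebra_simps)
    finally show "(x - x1) * x1 - c * (w - y1) * y1 = - c * y" .
    have "(x - x1) * y1 - (w - y1) * x1 = x * y1 - w * x1" by (simp add: algebra_simps)
    then show "(x - x1) * y1 - (w - y1) * x1 = - x" using im by simp
  qed (simp_all add: norm w_def)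
qed

lemma (in group) word_value_square:
  assumes "a \<in> carrier G" "b \<in> carrier G" "a' \<in> carrier G" "b' \<in> carrier G"
  shows "word_value G (map (\<lambda>g. g [^] (m::nat)) [a, b, inv a', inv b']) = \<one> \<longleftrightarrow>
    a [^] m \<otimes> b [^] m = b' [^] m \<otimes> a' [^] m"
proof -
  have "word_value G (map (\<lambda>g. g [^] m) [a, b, inv a', inv b']) = (a [^] m \<otimes> b [^] m) \<otimes> inv (b' [^] m \<otimes> a' [^] m)"
    using assms by (simp add: word_value_def m_assoc inv_mult_group nat_pow_inv)
  then show ?thesis using assms by (metis inv_closed inv_equality inv_inv m_closed nat_pow_closed r_inv)
qed

theorem theorem1:
  fixes c \<tau> :: "'a::{field,finite}" and p q k :: nat
  assumes "prime p" and "odd p" and "k \<ge> 1" and "q = p ^ k" and "CARD('a) = q"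
    and "\<tau> \<noteq> 0" and "\<tau> \<noteq> 1"
    and "c \<noteq> 0" and "\<not> (\<exists>x. c = x ^ 2)"
  shows "\<not> poly_context_free_group (\<Gamma> c \<tau>)"
proof
  assume pcf: "poly_context_free_group (\<Gamma> c \<tau>)"
  have card: "CARD('a) = p ^ k" using assms(4,5) by simp
  have odd: "odd CARD('a)" using assms(2) card by simp
  have one: "1 < CARD('a)" using card_mono[of UNIV "{0, 1 :: 'a}"] by simp
  have two: "(2::'a) \<noteq> 0"
  proof
    assume "(2::'a) = 0"
    then have "p dvd 2"
      using of_nat_eq_0_iff_char_dvd[of 2, where 'a = 'a] CHAR_of_prime_power_card[OF assms(1) card] by simp
    then show False using assms(1,2) by (metis primes_dvd_imp_eq two_is_prime_nat dvd_refl)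
  qed
  define n where "n = c * \<tau> / (1 - \<tau>)"
  \<comment> \<open>The ratio of \<open>\<omega>\<^sub>\<eta>\<^sup>2\<close> and \<open>\<omega>\<^sub>\<xi>\<^sup>2\<close>.\<close>
  define \<kappa> where "\<kappa> = \<tau> / (\<tau> - 1)"
  have n0: "n \<noteq> 0" using assms(6-8) by (simp add: n_def)
  have \<kappa>: "\<kappa> \<noteq> 0" "\<kappa> \<noteq> 1" using assms(6,7) by (simp_all add: \<kappa>_def)
  have n\<kappa>: "- c * n = \<kappa> * c ^ 2"
    using assms(7) by (simp add: n_def \<kappa>_def power2_eq_square field_simps)
  obtain x y where xy: "x \<noteq> 0" "x ^ 2 - c * y ^ 2 = n"
    using norm_represents[OF odd assms(9) n0 two] by blast
  obtain x1 y1 x2 y2 where sq: "x1 + x2 = x" "y1 + y2 = y + 1" "x1 ^ 2 - c * y1 ^ 2 = - c"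
      "x2 ^ 2 - c * y2 ^ 2 = x ^ 2 - c * y ^ 2"
      "x2 * x1 - c * y2 * y1 = - c * y" "x2 * y1 - y2 * x1 = - x"
    by (rule dual_square[OF xy(1) assms(9)])
  let ?G = "D_units_mod_K_units c" and ?S = "gens_A c \<union> gens_B c \<tau>" and ?u = "[:0, c:] :: 'a poly"
  interpret R: ring "D_alg c" unfolding D_alg_def by (rule ring_quat_ring)
  interpret U: group "units_of (D_alg c)" by (rule R.units_group)
  interpret N: normal K_units "units_of (D_alg c)" by (rule K_units_normal)
  interpret G: group ?G unfolding D_units_mod_K_units_def by (rule N.factorgroup_is_group)
  interpret \<Gamma>: group "\<Gamma> c \<tau>" unfolding \<Gamma>_def by (rule G.group_subgroup_generated)
  have \<Gamma>_mult: "a \<otimes>\<^bsub>\<Gamma> c \<tau>\<^esub> b = a \<otimes>\<^bsub>?G\<^esub> b" and \<Gamma>_pow: "a [^]\<^bsub>\<Gamma> c \<tau>\<^esub> m = a [^]\<^bsub>?G\<^esub> m"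
    and \<Gamma>_one: "\<one>\<^bsub>\<Gamma> c \<tau>\<^esub> = \<one>\<^bsub>?G\<^esub>" for a b and m :: nat
    by (simp_all add: \<Gamma>_def pow_subgroup_generated)
  define g where "g = (\<lambda>x y. quad_elem c x y ?u 1)"
  have unit: "g x y \<in> Units (D_alg c)" for x y
  proof -
    have "Quat (ratfun_const x) (ratfun_const y) 0 0 \<in> Fq_Z c" by (auto simp: Fq_Z_eq)
    from gen_elem_mult_conj[OF assms(8) this] show ?thesis
      unfolding gen_elem_eq g_def by (metis D_alg_def quat_ring_UnitsI quat_ring_simps(2))
  qed
  have mem: "D_class c (g x y) \<in> carrier (\<Gamma> c \<tau>)"
    if "x ^ 2 - c * y ^ 2 = - c \<or> x ^ 2 - c * y ^ 2 = n" for x y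
  proof -
    have "Quat (ratfun_const x) (ratfun_const y) 0 0 \<in> norm_fibre c (- c) \<union> norm_fibre c n"
      using that norm_fibreI[OF assms(1,2) card assms(9), of x y "- c"]
        norm_fibreI[OF assms(1,2) card assms(9), of x y n] assms(8) n0 by auto
    then have "D_class c (g x y) \<in> ?S"
      unfolding gens_A_def gens_B_def g_def n_def[symmetric] gen_elem_eq[symmetric] by blast
    then show ?thesis
      unfolding \<Gamma>_def using gens_generate_Gamma(1)[OF assms(8) odd]
      by (meson G.subgroup_generated_subset_carrier_subset subsetD)
  qed
  have nontrivial: "D_class c (g x y) \<noteq> \<one>\<^bsub>\<Gamma> c \<tau>\<^esub>" if "x \<noteq> 0 \<or> y \<noteq> 0" for x y
  proof
    assume "D_class c (g x y) = \<one>\<^bsub>\<Gamma> c \<tau>\<^esub>"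
    then have "D_class c (g x y) = D_class c \<one>\<^bsub>D_alg c\<^esub>"
      using D_class_hom(4)[OF unit unit] by (simp add: \<Gamma>_one)
    then obtain k where "g x y = quat_scalar k \<otimes>\<^bsub>D_alg c\<^esub> \<one>\<^bsub>D_alg c\<^esub>"
      using D_class_eq_iff[OF unit R.Units_one_closed] by blast
    then show False using that assms(8)
      by (auto simp: g_def quad_elem_def D_alg_def quat_defs const_poly_hom)
  qed
  define a b a' b' where defs: "a = D_class c (g 0 1)" "b = D_class c (g x y)"
      "a' = D_class c (g x1 y1)" "b' = D_class c (g x2 y2)"
  have car: "a \<in> carrier (\<Gamma> c \<tau>)" "b \<in> carrier (\<Gamma> c \<tau>)" "a' \<in> carrier (\<Gamma> c \<tau>)" "b' \<in> carrier (\<Gamma> c \<tau>)"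
    unfolding defs using xy(2) sq(3,4) by (auto intro!: mem)
  have "x1 \<noteq> 0 \<or> y1 \<noteq> 0" "x2 \<noteq> 0 \<or> y2 \<noteq> 0" using sq(3,4) xy(2) n0 assms(8) by auto
  then have nt: "a \<noteq> \<one>\<^bsub>\<Gamma> c \<tau>\<^esub>" "b \<noteq> \<one>\<^bsub>\<Gamma> c \<tau>\<^esub>" "a' \<noteq> \<one>\<^bsub>\<Gamma> c \<tau>\<^esub>" "b' \<noteq> \<one>\<^bsub>\<Gamma> c \<tau>\<^esub>"
    unfolding defs using xy(1) by (auto intro!: nontrivial)
  let ?e = "const_poly (c ^ 2) * T_poly" and ?e' = "const_poly (\<kappa> * c ^ 2) * T_poly"
  let ?gs = "[a, b, inv\<^bsub>\<Gamma> c \<tau>\<^esub> a', inv\<^bsub>\<Gamma> c \<tau>\<^esub> b']"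
  have relation: "word_value (\<Gamma> c \<tau>) (map (\<lambda>h. h [^]\<^bsub>\<Gamma> c \<tau>\<^esub> m) ?gs) = \<one>\<^bsub>\<Gamma> c \<tau>\<^esub> \<longleftrightarrow>
      fst (quad_pow ?u ?e m) * snd (quad_pow ?u ?e' m) = fst (quad_pow ?u ?e' m) * snd (quad_pow ?u ?e m)"
    if nz: "snd (quad_pow ?u ?e m) \<noteq> 0" "snd (quad_pow ?u ?e' m) \<noteq> 0" for m
  proof -
    have e: "const_poly (- c * - c) * T_poly = ?e" "const_poly (- c * n) * T_poly = ?e'"
      by (simp_all only: n\<kappa>) (simp add: power2_eq_square)
    have pow_a: "g z w [^]\<^bsub>D_alg c\<^esub> m = quad_elem c z w (fst (quad_pow ?u ?e m)) (snd (quad_pow ?u ?e m))"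
      if "z ^ 2 - c * w ^ 2 = - c" for z w
      unfolding g_def quad_elem_pow that e ..
    have pow_b: "g z w [^]\<^bsub>D_alg c\<^esub> m = quad_elem c z w (fst (quad_pow ?u ?e' m)) (snd (quad_pow ?u ?e' m))"
      if "z ^ 2 - c * w ^ 2 = n" for z w
      unfolding g_def quad_elem_pow that e ..
    have units: "g z w [^]\<^bsub>D_alg c\<^esub> m \<in> Units (D_alg c)" for z w using unit by (rule R.Units_nat_pow_closed)
    have "word_value (\<Gamma> c \<tau>) (map (\<lambda>h. h [^]\<^bsub>\<Gamma> c \<tau>\<^esub> m) ?gs) = \<one>\<^bsub>\<Gamma> c \<tau>\<^esub> \<longleftrightarrow>
        a [^]\<^bsub>\<Gamma> c \<tau>\<^esub> m \<otimes>\<^bsub>\<Gamma> c \<tau>\<^esub> b [^]\<^bsub>\<Gamma> c \<tau>\<^esub> m = b' [^]\<^bsub>\<Gamma> c \<tau>\<^esub> m \<otimes>\<^bsub>\<Gamma> c \<tau>\<^esub> a' [^]\<^bsub>\<Gamma> c \<tau>\<^esub> m"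
      by (rule \<Gamma>.word_value_square[OF car])
    also have "\<dots> \<longleftrightarrow> D_class c (g 0 1 [^]\<^bsub>D_alg c\<^esub> m \<otimes>\<^bsub>D_alg c\<^esub> g x y [^]\<^bsub>D_alg c\<^esub> m) =
        D_class c (g x2 y2 [^]\<^bsub>D_alg c\<^esub> m \<otimes>\<^bsub>D_alg c\<^esub> g x1 y1 [^]\<^bsub>D_alg c\<^esub> m)"
      unfolding \<Gamma>_mult \<Gamma>_pow defs D_class_hom(3)[OF unit unit] D_class_hom(2)[OF units units] ..
    also have "\<dots> \<longleftrightarrow> fst (quad_pow ?u ?e m) * snd (quad_pow ?u ?e' m) = fst (quad_pow ?u ?e' m) * snd (quad_pow ?u ?e m)"
      unfolding D_class_eq_iff[OF R.Units_m_closed[OF units units] R.Units_m_closed[OF units units]]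
      using xy(2) sq(3,4) twisted_commutation[OF assms(8) xy(1) two nz sq(1,2,5,6)]
      by (simp add: pow_a pow_b)
    finally show ?thesis .
  qed
  \<comment> \<open>The exponents for which Frobenius gives all four generators the same coefficients.\<close>
  define N where "N = (\<lambda>i. CARD('a) ^ (2 * i))"
  have "word_value (\<Gamma> c \<tau>) (map (\<lambda>h. h [^]\<^bsub>\<Gamma> c \<tau>\<^esub> N i) ?gs) = \<one>\<^bsub>\<Gamma> c \<tau>\<^esub>" for i
  proof -
    have "quad_pow ?u ?e (N i) = (?u ^ N i, T_poly ^ ((N i - 1) div 2))"
        "quad_pow ?u ?e' (N i) = (?u ^ N i, T_poly ^ ((N i - 1) div 2))"
      using frobenius_quad_pow[OF assms(1,2) card, of "N i" i] assms(8) \<kappa>(1) by (simp_all add: N_def)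
    then show ?thesis by (subst relation) simp_all
  qed
  moreover have "set ?gs \<subseteq> carrier (\<Gamma> c \<tau>) - {\<one>\<^bsub>\<Gamma> c \<tau>\<^esub>}"
    using car nt by (simp add: \<Gamma>.inv_eq_1_iff)
  moreover have "N i \<ge> 1" for i by (simp add: N_def)
  ultimately obtain i j where ij: "i < j" and
      "word_value (\<Gamma> c \<tau>) (map (\<lambda>h. h [^]\<^bsub>\<Gamma> c \<tau>\<^esub> (2 * N j - N i)) ?gs) = \<one>\<^bsub>\<Gamma> c \<tau>\<^esub>"
    using \<Gamma>.poly_context_free_group_extrapolation[OF pcf, of ?gs N] by blast
  then show False
    using relation[of "2 * N j - N i"]
      extrapolated_exponent_separates[OF assms(1,2) card ij assms(8) \<kappa>]
    unfolding N_def by blast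
qed

end
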